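(* Consider the Nicholson equation with one pair of delays $$x'(t)=\beta(t)\big(p\,x(t-\tau(t))\,e^{-a x(t-\sigma(t))}-\delta x(t)\big),\qquad t\ge t_0,$$ where $p,a,\delta\in(0,\infty)$, and $\beta,\sigma,\tau:[t_0,\infty)\to[0,\infty)$ are continuous and bounded with $\inf_{t\ge t_0}\beta(t)>0$. Let $\zeta_M:=\limsup_{t\to\infty}\int_{t-\sigma(t)}^t\beta(s)\,ds$, let $p>\delta$, let $K=\frac1a\log\frac p\delta$ be the positive equilibrium, and assume that one of the following conditions holds: (i) $\displaystyle\log(p/\delta)\le\frac{2\delta\zeta_M}{e^{\delta\zeta_M}-\delta\zeta_M-1}$ and $\delta\zeta_M\,(2+\log(p/\delta))<1$; (ii) $\displaystyle\log(p/\delta)>\frac{2\delta\zeta_M}{e^{\delta\zeta_M}-\delta\zeta_M-1}$ and $(e^{\delta\zeta_M}-1)\log\frac p\delta\le 1$. Then the equilibrium $K$ is globally asymptotically stable (in $C_0^+$).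
   Context: Let $\bar\tau=\max\{\sup_{t\ge t_0}\tau(t),\sup_{t\ge t_0}\sigma(t)\}$. The phase space is $C=C([-\bar\tau,0];\mathbb{R})$ with the supremum norm $\|\cdot\|$, and the set of admissible initial conditions is $C_0^+=\{\phi\in C:\phi(\theta)\ge 0\text{ for }\theta\in[-\bar\tau,0),\ \phi(0)>0\}$. For $\phi\in C_0^+$, $x(t;t_0,\phi)$ denotes the solution with $x(t_0+\theta)=\phi(\theta)$ for $\theta\in[-\bar\tau,0]$; such solutions are defined and positive on $[t_0,\infty)$. $K$ is globally asymptotically stable (in $C_0^+$) if it is stable, in the usual sense with respect to solutions with initial conditions in $C_0^+$, and globally attractive, i.e. $\lim_{t\to\infty}x(t;t_0,\phi)=K$ for every $\phi\in C_0^+$. *)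

theory Defs
  imports "HOL-Analysis.Analysis"
begin

text \<open>
  The phase space \<open>C([-r,0]; \<real>)\<close> is represented by functions of type
  \<^typ>\<open>real \<Rightarrow> real\<close>, of which only the values on \<open>{-r..0}\<close> matter.
\<close>

definition sup_norm :: "real \<Rightarrow> (real \<Rightarrow> real) \<Rightarrow> real" where
  "sup_norm r \<phi> = (SUP \<theta>\<in>{-r..0}. \<bar>\<phi> \<theta>\<bar>)"

definition C0_plus :: "real \<Rightarrow> (real \<Rightarrow> real) set" where
  "C0_plus r = {\<phi>. continuous_on {-r..0} \<phi> \<and> (\<forall>\<theta>\<in>{-r..<0}. 0 \<le> \<phi> \<theta>) \<and> 0 < \<phi> 0}"

definition segment :: "(real \<Rightarrow> real) \<Rightarrow> real \<Rightarrow> real \<Rightarrow> real" where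
  "segment x t = (\<lambda>\<theta>. x (t + \<theta>))"

text \<open>
  Solutions on \<open>[t0, \<infinity>)\<close> of \<open>x'(t) = f(t, x\<^sub>t)\<close> with initial function \<open>\<phi>\<close> at time \<open>t0\<close>;
  at \<open>t = t0\<close> the derivative is the right-hand one.
\<close>

definition dde_solution ::
  "(real \<Rightarrow> (real \<Rightarrow> real) \<Rightarrow> real) \<Rightarrow> real \<Rightarrow> real \<Rightarrow> (real \<Rightarrow> real) \<Rightarrow> (real \<Rightarrow> real) \<Rightarrow> bool" where
  "dde_solution f t0 r \<phi> x \<longleftrightarrow>
     (\<forall>\<theta>\<in>{-r..0}. x (t0 + \<theta>) = \<phi> \<theta>) \<and>
     (\<forall>t\<ge>t0. (x has_real_derivative f t (segment x t)) (at t within {t0..}))"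

definition stable_in_C0_plus ::
  "(real \<Rightarrow> (real \<Rightarrow> real) \<Rightarrow> real) \<Rightarrow> real \<Rightarrow> real \<Rightarrow> real \<Rightarrow> bool" where
  "stable_in_C0_plus f t0 r K \<longleftrightarrow>
     (\<forall>\<epsilon>>0. \<exists>\<eta>>0. \<forall>\<phi>\<in>C0_plus r. \<forall>x. dde_solution f t0 r \<phi> x \<longrightarrow>
        sup_norm r (\<lambda>\<theta>. \<phi> \<theta> - K) < \<eta> \<longrightarrow> (\<forall>t\<ge>t0. \<bar>x t - K\<bar> < \<epsilon>))"

definition globally_attractive_in_C0_plus ::
  "(real \<Rightarrow> (real \<Rightarrow> real) \<Rightarrow> real) \<Rightarrow> real \<Rightarrow> real \<Rightarrow> real \<Rightarrow> bool" where
  "globally_attractive_in_C0_plus f t0 r K \<longleftrightarrow>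
     (\<forall>\<phi>\<in>C0_plus r. \<forall>x. dde_solution f t0 r \<phi> x \<longrightarrow> (x \<longlongrightarrow> K) at_top)"

definition globally_asymptotically_stable_in_C0_plus ::
  "(real \<Rightarrow> (real \<Rightarrow> real) \<Rightarrow> real) \<Rightarrow> real \<Rightarrow> real \<Rightarrow> real \<Rightarrow> bool" where
  "globally_asymptotically_stable_in_C0_plus f t0 r K \<longleftrightarrow>
     stable_in_C0_plus f t0 r K \<and> globally_attractive_in_C0_plus f t0 r K"

definition nicholson_rhs ::
  "real \<Rightarrow> real \<Rightarrow> real \<Rightarrow> (real \<Rightarrow> real) \<Rightarrow> (real \<Rightarrow> real) \<Rightarrow> (real \<Rightarrow> real) \<Rightarrow>
   real \<Rightarrow> (real \<Rightarrow> real) \<Rightarrow> real" where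
  "nicholson_rhs p a \<delta> \<beta> \<sigma> \<tau> t \<psi> =
     \<beta> t * (p * \<psi> (- \<tau> t) * exp (- a * \<psi> (- \<sigma> t)) - \<delta> * \<psi> 0)"

definition max_delay :: "real \<Rightarrow> (real \<Rightarrow> real) \<Rightarrow> (real \<Rightarrow> real) \<Rightarrow> real" where
  "max_delay t0 \<sigma> \<tau> = max (SUP t\<in>{t0..}. \<tau> t) (SUP t\<in>{t0..}. \<sigma> t)"

text \<open>
  The upper limit is taken in the extended reals, where it always exists. It depends only on large
  \<open>t\<close>; when \<open>\<sigma>\<close> is bounded, \<open>t - \<sigma> t \<ge> t0\<close> for those, so values of \<open>\<beta>\<close> before \<open>t0\<close> are irrelevant.
\<close>

definition zeta_M :: "(real \<Rightarrow> real) \<Rightarrow> (real \<Rightarrow> real) \<Rightarrow> ereal" where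
  "zeta_M \<beta> \<sigma> = Limsup at_top (\<lambda>t. ereal (integral {t - \<sigma> t..t} \<beta>))"

end

theory Submission
  imports Defs
begin

text \<open>
  After rescaling, the equation reads \<open>x' = \<beta> (x(t - \<tau>) exp (K - x(t - \<sigma>)) - x)\<close>, and each of
  (i), (ii) implies \<open>K (exp \<zeta> - 1) \<le> 1\<close>. Put \<open>w = exp (- \<zeta>)\<close>.

  Attractivity: at times where \<open>x\<close> is nearly extremal with almost vanishing derivative, the
  delayed value \<open>x(t - \<sigma>)\<close> lies on the other side of \<open>K\<close>. Integrating the equation from \<open>t - \<sigma>\<close>
  to \<open>t\<close> gives, for the lower and upper limits \<open>l\<close> and \<open>L\<close> (truncated at \<open>K\<close>),
  \<open>l \<ge> w K + (1 - w) l exp (K - L)\<close> and \<open>L \<le> w K + (1 - w) L exp (K - l)\<close>. Dropping the second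
  summand in the first bound gives \<open>l \<ge> w K\<close> without any upper bound on \<open>x\<close>, and
  \<open>(1 - w) exp (K - w K) < 1\<close> then makes \<open>x\<close> bounded. The two inequalities force \<open>l = L = K\<close>.

  Stability: on bounded time intervals deviations grow at most by a fixed factor; for large \<open>t\<close> a
  first-hitting argument shows that small deviations cannot increase.
\<close>

section \<open>Extrema, hitting times and an exponential comparison principle\<close>

lemma DERIV_nonneg_at_left_max:
  fixes f :: "real \<Rightarrow> real"
  assumes "DERIV f t :> l" "a < t" "\<And>u. a \<le> u \<Longrightarrow> u < t \<Longrightarrow> f u \<le> f t"
  shows "0 \<le> l"
proof (rule ccontr)
  assume "\<not> 0 \<le> l"
  then obtain d where d: "d > 0" "\<forall>h>0. h < d \<longrightarrow> f t < f (t - h)"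
    using DERIV_neg_dec_left[OF assms(1)] by auto
  define h where "h = min (d/2) (t - a)"
  have "h > 0" "h < d" "a \<le> t - h" using d(1) assms(2) by (auto simp: h_def)
  then show False using d(2) assms(3)[of "t - h"] by force
qed

lemma first_hitting_time:
  fixes f :: "real \<Rightarrow> real"
  assumes "a \<le> b" "continuous_on {a..b} f" "f a < c" "c \<le> f b"
  obtains t where "a < t" "t \<le> b" "f t = c" "\<And>u. a \<le> u \<Longrightarrow> u < t \<Longrightarrow> f u < c"
proof -
  define S where "S = {u \<in> {a..b}. f u = c}"
  have "compact S"
    unfolding S_def using assms(2) continuous_closed_preimage_constant[of "{a..b}" f c]
    by (metis (no_types, lifting) closed_atLeastAtMost compact_Icc compact_Int_closed inf.absorb2 mem_Collect_eq subsetI)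
  moreover have "S \<noteq> {}"
    using IVT'[of f a c b] assms by (force simp: S_def)
  ultimately obtain t where t: "t \<in> S" "\<And>u. u \<in> S \<Longrightarrow> t \<le> u"
    using compact_attains_inf by metis
  have tab: "a \<le> t" "t \<le> b" "f t = c" using t(1) by (auto simp: S_def)
  have "f u < c" if u: "a \<le> u" "u < t" for u
  proof (rule ccontr)
    assume "\<not> f u < c"
    moreover have "continuous_on {a..u} f"
      using assms(2) by (rule continuous_on_subset) (use u tab in auto)
    ultimately obtain v where "a \<le> v" "v \<le> u" "f v = c"
      using IVT'[of f a c u] assms u by force
    then show False using t(2)[of v] u tab by (auto simp: S_def)
  qed
  moreover have "a < t" using tab assms by (cases "a = t") auto
  ultimately show ?thesis using that tab by blast
qed

text \<open>Reversing time and negating \<open>f\<close> turns the last zero into a first hitting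
  time of level \<open>0\<close>.\<close>

lemma last_zero:
  fixes f :: "real \<Rightarrow> real"
  assumes "a \<le> b" "continuous_on {a..b} f" "f a \<le> 0" "0 < f b"
  obtains t where "a \<le> t" "t < b" "f t = 0" "\<And>u. t < u \<Longrightarrow> u \<le> b \<Longrightarrow> 0 < f u"
proof -
  have "continuous_on {-b..-a} (\<lambda>u. - f (- u))"
    by (intro continuous_intros continuous_on_compose2[OF assms(2)]) auto
  then obtain t where t: "- b < t" "t \<le> - a" "- f (- t) = 0"
      "\<And>u. - b \<le> u \<Longrightarrow> u < t \<Longrightarrow> - f (- u) < 0"
    using first_hitting_time[of "-b" "-a" "\<lambda>u. - f (- u)" 0] assms by auto
  show ?thesis
  proof (rule that[of "-t"])
    show "0 < f u" if "- t < u" "u \<le> b" for u using t(4)[of "-u"] that by simp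
  qed (use t in auto)
qed

text \<open>Integrating factor: the differential inequality makes
  \<open>(z u - C) * exp (B u)\<close> nonincreasing. With \<open>B\<close> as the clock, the
  resulting bound relaxes towards \<open>C\<close> at unit rate.\<close>

lemma exp_comparison:
  fixes z B :: "real \<Rightarrow> real"
  assumes "s \<le> t" "continuous_on {s..t} z" "continuous_on {s..t} B"
    and z: "\<And>u. s < u \<Longrightarrow> u < t \<Longrightarrow> DERIV z u :> z' u"
    and B: "\<And>u. s < u \<Longrightarrow> u < t \<Longrightarrow> DERIV B u :> \<beta> u"
    and le: "\<And>u. s < u \<Longrightarrow> u < t \<Longrightarrow> z' u \<le> \<beta> u * (C - z u)"
  shows "z t \<le> C + (z s - C) * exp (- (B t - B s))"
proof (cases "s = t")
  case False
  then have st: "s < t" using assms by simp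
  have "(z t - C) * exp (B t) \<le> (z s - C) * exp (B s)"
  proof (rule DERIV_nonpos_imp_decreasing_open[OF less_imp_le[OF st]])
    fix u assume u: "s < u" "u < t"
    have "DERIV (\<lambda>u. (z u - C) * exp (B u)) u :> (z' u + (z u - C) * \<beta> u) * exp (B u)"
      by (rule derivative_eq_intros z[OF u] B[OF u] refl | simp add: algebra_simps)+
    moreover have "(z' u + (z u - C) * \<beta> u) * exp (B u) \<le> 0"
      using le[OF u] by (intro mult_nonpos_nonneg) (simp_all add: algebra_simps)
    ultimately show "\<exists>y. DERIV (\<lambda>u. (z u - C) * exp (B u)) u :> y \<and> y \<le> 0" by blast
  qed (intro continuous_intros assms)
  then have "(z t - C) * exp (B t) * exp (- B t) \<le> (z s - C) * exp (B s) * exp (- B t)"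
    by (rule mult_right_mono) simp
  then have "z t - C \<le> (z s - C) * exp (B s - B t)"
    by (simp add: mult.assoc mult_exp_exp)
  then show ?thesis by simp
qed auto

section \<open>Near-extremal times and truncated limits\<close>

text \<open>Tilt \<open>f\<close> by \<open>\<epsilon> * u\<close> and maximise over a long interval
  \<open>{T..t}\<close>: at the maximiser \<open>f\<close> is still above \<open>c\<close>, and
  being a maximum from the left gives slope at least \<open>- \<epsilon>\<close>.\<close>

lemma fluctuation:
  fixes f :: "real \<Rightarrow> real"
  assumes f: "\<And>t. T \<le> t \<Longrightarrow> DERIV f t :> f' t"
    and freq: "\<And>S. \<exists>t\<ge>S. c < f t" and "0 < \<epsilon>"
  shows "\<exists>t\<ge>T. c < f t \<and> - \<epsilon> \<le> f' t"
proof (rule ccontr)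
  assume "\<not> ?thesis"
  then have neg: "f' t < - \<epsilon>" if "T \<le> t" "c < f t" for t using that by force
  define g where "g u = f u + \<epsilon> * u" for u
  \<comment> \<open>Beyond \<open>S\<close> the tilt outweighs the value \<open>f T\<close>. This
    excludes \<open>T\<close> as the maximiser, the only point with nothing to its left to compare
    with.\<close>
  define S where "S = T + \<bar>f T - c\<bar> / \<epsilon>"
  obtain t where t: "t \<ge> S" "c < f t" using freq by blast
  have "T \<le> S" using \<open>0 < \<epsilon>\<close> by (simp add: S_def)
  then have "T \<le> t" using t by simp
  have g: "DERIV g u :> f' u + \<epsilon>" if "T \<le> u" for u
    unfolding g_def by (rule derivative_eq_intros f[OF that] refl | simp)+
  have "continuous_on {T..t} g"
    by (rule continuous_at_imp_continuous_on) (auto intro: DERIV_isCont[OF g])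
  then obtain m where m: "T \<le> m" "m \<le> t" "\<And>u. T \<le> u \<Longrightarrow> u \<le> t \<Longrightarrow> g u \<le> g m"
    using continuous_attains_sup[of "{T..t}" g] \<open>T \<le> t\<close> by auto
  have ct: "c + \<epsilon> * t < g t" using t by (simp add: g_def)
  also have "g t \<le> g m" using m \<open>T \<le> t\<close> by simp
  finally have "c + \<epsilon> * t < f m + \<epsilon> * m" by (simp add: g_def)
  moreover have "\<epsilon> * m \<le> \<epsilon> * t" using m \<open>0 < \<epsilon>\<close> by simp
  ultimately have "c < f m" by simp
  then have "f' m + \<epsilon> < 0" using neg m by force
  have "m = T"
  proof (rule ccontr)
    assume "m \<noteq> T"
    then have "0 \<le> f' m + \<epsilon>"
      using DERIV_nonneg_at_left_max[OF g[OF m(1)], of T] m by auto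
    then show False using \<open>f' m + \<epsilon> < 0\<close> by simp
  qed
  then have "c + \<epsilon> * t < f T + \<epsilon> * T" using \<open>c + \<epsilon> * t < f m + \<epsilon> * m\<close> by simp
  moreover have "\<epsilon> * S = \<epsilon> * T + \<bar>f T - c\<bar>" using \<open>0 < \<epsilon>\<close> by (simp add: S_def field_simps)
  moreover have "\<epsilon> * S \<le> \<epsilon> * t" using t \<open>0 < \<epsilon>\<close> by simp
  ultimately show False by linarith
qed

text \<open>\<open>l\<close> is the supremum of the eventual lower bounds not exceeding
  \<open>k\<close>; the cap makes it exist even if \<open>f\<close> is unbounded above. Below the
  cap, \<open>f\<close> must return near \<open>l\<close> at arbitrarily late times, as otherwise
  \<open>l\<close> could be raised. Applied to \<open>- x\<close>, it yields the truncated upper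
  limit.\<close>

lemma truncated_liminf:
  fixes f :: "real \<Rightarrow> real"
  assumes "m \<le> k" "\<forall>\<^sub>F t in at_top. m \<le> f t"
  obtains l where "m \<le> l" "l \<le> k" "\<And>\<epsilon>. 0 < \<epsilon> \<Longrightarrow> \<forall>\<^sub>F t in at_top. l - \<epsilon> \<le> f t"
    "\<And>\<epsilon> S. l < k \<Longrightarrow> 0 < \<epsilon> \<Longrightarrow> \<exists>t\<ge>S. f t < l + \<epsilon>"
proof -
  define A where "A = {c. c \<le> k \<and> (\<forall>\<^sub>F t in at_top. c \<le> f t)}"
  have mA: "m \<in> A" using assms by (simp add: A_def)
  have bdd: "bdd_above A" by (auto simp: A_def bdd_above_def)
  show ?thesis
  proof (rule that[of "Sup A"])
    show "m \<le> Sup A" using mA bdd by (rule cSup_upper)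
    show "Sup A \<le> k" using mA by (intro cSup_least) (auto simp: A_def)
    show "\<forall>\<^sub>F t in at_top. Sup A - \<epsilon> \<le> f t" if "0 < \<epsilon>" for \<epsilon>
    proof -
      have "Sup A - \<epsilon> < Sup A" using that by simp
      then obtain c where "c \<in> A" "Sup A - \<epsilon> < c"
        using less_cSup_iff[of A "Sup A - \<epsilon>"] mA bdd by blast
      then show ?thesis by (auto simp: A_def elim!: eventually_mono)
    qed
    show "\<exists>t\<ge>S. f t < Sup A + \<epsilon>" if "Sup A < k" "0 < \<epsilon>" for \<epsilon> S
    proof (rule ccontr)
      assume "\<not> ?thesis"
      then have "\<forall>\<^sub>F t in at_top. min k (Sup A + \<epsilon>) \<le> f t"
        by (auto simp: eventually_at_top_linorder not_less intro!: exI[of _ S] min.coboundedI2)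
      then have "min k (Sup A + \<epsilon>) \<in> A" by (simp add: A_def)
      then have "min k (Sup A + \<epsilon>) \<le> Sup A" using bdd by (rule cSup_upper)
      then show False using that by auto
    qed
  qed
qed

section \<open>Scalar inequalities that force the two limits to coincide\<close>

text \<open>The difference of the two sides vanishes at \<open>0\<close> and has derivative
  \<open>1 - exp (- u) * (1 + u)\<close>, positive by \<open>1 + u < exp u\<close>. Rearranged,
  \<open>exp (- v)\<close> lies above its first Pade approximant
  \<open>(2 - v) / (2 + v)\<close>.\<close>

lemma exp_minus_pade:
  fixes v :: real
  assumes "0 < v"
  shows "(1 - exp (- v)) * (2 + v) < 2 * v"
proof -
  define f where "f v = 2 * v - (1 - exp (- v)) * (2 + v)" for v :: real
  have d: "DERIV f u :> 1 - exp (- u) * (1 + u)" for u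
    unfolding f_def by (rule derivative_eq_intros refl | simp add: algebra_simps)+
  have "f 0 < f v"
  proof (rule DERIV_pos_imp_increasing_open[OF assms])
    fix u :: real assume u: "0 < u" "u < v"
    have "1 + u < exp u" using u exp_minus_greater[of "-u"] by simp
    then have "exp (- u) * (1 + u) < 1" by (simp add: exp_minus field_simps)
    then show "\<exists>y. DERIV f u :> y \<and> y > 0" using d by (intro exI[of _ "1 - exp (- u) * (1 + u)"]) auto
  qed (intro continuous_at_imp_continuous_on ballI DERIV_isCont[OF d])
  then show ?thesis by (simp add: f_def)
qed

text \<open>The derivative of the difference reduces to
  \<open>ln (1 + u) - (1 - 1 / (1 + u))\<close>, nonnegative by \<open>ln y \<le> y - 1\<close> at
  \<open>y = 1 / (1 + u)\<close>. The quotient \<open>2 * z / (2 + z)\<close> is the first Pade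
  approximant of \<open>ln (1 + z)\<close>.\<close>

lemma ln_1p_pade:
  fixes z :: real
  assumes "0 \<le> z"
  shows "2 * z \<le> ln (1 + z) * (2 + z)"
proof -
  define f where "f z = ln (1 + z) * (2 + z) - 2 * z" for z :: real
  have d: "DERIV f u :> (2 + u) / (1 + u) + ln (1 + u) - 2" if "0 \<le> u" for u
    unfolding f_def using that by (auto intro!: derivative_eq_intros simp: add_nonneg_pos)
  have "f 0 \<le> f z"
  proof (rule DERIV_nonneg_imp_nondecreasing[OF assms])
    fix u :: real assume u: "0 \<le> u" "u \<le> z"
    have "ln (1 / (1 + u)) \<le> 1 / (1 + u) - 1" using u by (intro ln_le_minus_one) auto
    then have "1 - 1 / (1 + u) \<le> ln (1 + u)" using u by (simp add: ln_div)
    moreover have "(2 + u) / (1 + u) = 1 + 1 / (1 + u)" using u by (simp add: field_simps)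
    ultimately show "\<exists>y. DERIV f u :> y \<and> y \<ge> 0" using d[OF u(1)]
      by (intro exI[of _ "(2 + u) / (1 + u) + ln (1 + u) - 2"]) auto
  qed
  then show ?thesis by (simp add: f_def)
qed

text \<open>With \<open>z = v / (1 + q v)\<close> the two bounds give
  \<open>ln (1 + z) \<le> u \<le> E / (1 + q E)\<close>. By \<open>ln (1 + z) \<ge> 2 z / (2 + z)\<close> the parameter \<open>q\<close> drops out
  and \<open>(1 - exp (- v)) (2 + v) \<ge> 2 v\<close> remains, which fails for \<open>v > 0\<close>.\<close>

lemma fluctuation_bounds_collapse:
  fixes K l L w :: real
  assumes "0 < l" "l \<le> K" "K \<le> L" "0 < w" "w \<le> 1" and Kw: "K * (1 - w) \<le> w"
    and l: "w * K + (1 - w) * (l * exp (K - L)) \<le> l"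
    and L: "L \<le> w * K + (1 - w) * (L * exp (K - l))"
  shows "l = K \<and> L = K"
proof -
  \<comment> \<open>For \<open>w = exp (- \<zeta>)\<close> the ratio \<open>q\<close> is
    \<open>exp \<zeta> - 1\<close>, so the hypothesis relating \<open>K\<close> and \<open>w\<close>
    becomes \<open>K * q \<le> 1\<close>.\<close>
  define u v q where "u = K - l" and "v = L - K" and "q = (1 - w) / w"
  define E F where "E = 1 - exp (- v)" and "F = exp u - 1"
  have q: "0 \<le> q" "K * q \<le> 1" "1 - w = q * w"
    using assms by (auto simp: q_def field_simps)
  have "w * (u * (1 + q * E)) \<le> w * (K * q * E)"
  proof -
    \<comment> \<open>Since \<open>w + q * w = 1\<close>, splitting \<open>l\<close> this way leaves
      a common factor \<open>w\<close>, which is then cancelled.\<close>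
    have "l = w * l + q * w * l" by (metis add_diff_cancel_left' diff_add_cancel distrib_right mult_1 q(3))
    then show ?thesis using l unfolding q(3) by (simp add: u_def v_def E_def algebra_simps)
  qed
  then have 1: "u * (1 + q * E) \<le> K * q * E" using \<open>0 < w\<close> by simp
  have "w * v \<le> w * ((K + v) * q * F)"
  proof -
    have "L = w * L + q * w * L" by (metis add_diff_cancel_left' diff_add_cancel distrib_right mult_1 q(3))
    then show ?thesis using L unfolding q(3) by (simp add: u_def v_def F_def algebra_simps)
  qed
  then have 2: "v \<le> (K + v) * q * F" using \<open>0 < w\<close> by simp
  have uv: "0 \<le> u" "0 \<le> v" using assms by (auto simp: u_def v_def)
  have EF: "0 \<le> E" "0 \<le> F" using uv by (auto simp: E_def F_def)
  \<comment> \<open>\<open>K * q \<le> 1\<close> eliminates \<open>K\<close> from both estimates;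
    only \<open>q\<close>, \<open>u\<close> and \<open>v\<close> remain.\<close>
  have 3: "u * (1 + q * E) \<le> E" using 1 mult_right_mono[OF q(2) EF(1)] by simp
  have 4: "v \<le> (1 + q * v) * F" using 2 mult_right_mono[OF q(2) EF(2)] by (simp add: algebra_simps)
  have "v = 0"
  proof (rule ccontr)
    assume "v \<noteq> 0"
    then have v: "0 < v" using uv by simp
    define z where "z = v / (1 + q * v)"
    have p: "0 < 1 + q * v" "0 < 1 + q * E" using q EF v by (simp_all add: add_pos_nonneg)
    have z: "0 < z" using v p by (simp add: z_def)
    have "z \<le> F" using 4 p by (simp add: z_def field_simps)
    then have "1 + z \<le> exp u" by (simp add: F_def)
    then have "ln (1 + z) \<le> u" using z by (metis add_pos_pos ln_exp ln_mono zero_less_one)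
    then have "2 * z \<le> u * (2 + z)" using ln_1p_pade[of z] z
      by (smt (verit) mult_right_mono)
    then have "2 * z * (1 + q * v) \<le> u * (2 + z) * (1 + q * v)" using p by simp
    moreover have "z * (1 + q * v) = v" using p by (simp add: z_def)
    moreover have "u * (2 + z) * (1 + q * v) = u * (2 * (1 + q * v) + z * (1 + q * v))"
      by (simp only: distrib_left distrib_right mult.assoc)
    ultimately have "2 * v \<le> u * (2 * (1 + q * v) + v)" by (simp only: mult.assoc)
    then have "2 * v * (1 + q * E) \<le> u * (2 * (1 + q * v) + v) * (1 + q * E)"
      using p(2) by simp
    also have "\<dots> = u * (1 + q * E) * (2 * (1 + q * v) + v)" by simp
    also have "\<dots> \<le> E * (2 * (1 + q * v) + v)"
      using 3 p v by (intro mult_right_mono) auto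
    \<comment> \<open>Both sides contain \<open>2 * q * v * E\<close>; cancelling it removes
      \<open>q\<close>.\<close>
    finally have "2 * v \<le> E * (2 + v)" by (simp add: algebra_simps)
    then show False using exp_minus_pade[OF v] by (simp add: E_def)
  qed
  then have "E = 0" by (simp add: E_def)
  then have "u \<le> 0" using 3 by simp
  then show ?thesis using uv \<open>v = 0\<close> by (simp add: u_def v_def)
qed

section \<open>Small parameters, and exclusion of a first exit from a small neighbourhood\<close>

lemma eventually_at_right_0_witness:
  assumes "eventually P (at_right (0::real))"
  shows "\<exists>\<eta>>0. P \<eta>"
proof -
  obtain b where "0 < b" "\<And>y. 0 < y \<Longrightarrow> y < b \<Longrightarrow> P y"
    using assms by (auto simp: eventually_at_right_field)
  then show ?thesis by (intro exI[of _ "b / 2"]) auto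
qed

text \<open>The deviation \<open>z\<close> cannot reach the level \<open>V\<close>. Measure time from the last zero \<open>s1\<close> by
  \<open>B\<close>. A delayed value close to \<open>- V\<close> lies well before \<open>s1\<close>, since \<open>z\<close> has slope at most
  \<open>C V\<close>; the delay bound \<open>\<xi>\<close> therefore excludes such values after \<open>B\<close>-time \<open>\<xi> - c\<close>, where the
  stronger bound \<open>G2\<close> applies. This gain is what gives stability when \<open>K * (exp \<zeta> - 1) = 1\<close>,
  where \<open>G1\<close> alone yields no contraction.\<close>

lemma first_hit_impossible:
  fixes z B \<sigma> :: "real \<Rightarrow> real"
  assumes cont: "continuous_on {a..t} z" "continuous_on {a..t} B"
    and z: "\<And>u. a < u \<Longrightarrow> u < t \<Longrightarrow> DERIV z u :> z' u"
    and B: "\<And>u. a < u \<Longrightarrow> u < t \<Longrightarrow> DERIV B u :> \<beta> u"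
    and \<beta>: "\<And>u. a < u \<Longrightarrow> u < t \<Longrightarrow> 0 \<le> \<beta> u"
    and \<sigma>t: "0 \<le> \<sigma> t"
    and \<sigma>: "\<And>u. t - \<sigma> t \<le> u \<Longrightarrow> u \<le> t \<Longrightarrow> a \<le> u - \<sigma> u \<and> 0 \<le> \<sigma> u \<and> B u - B (u - \<sigma> u) \<le> \<xi>"
    and lip: "\<And>u. a < u \<Longrightarrow> u < t \<Longrightarrow> z' u \<le> \<beta> u * (C * V)"
    and G1: "\<And>u. t - \<sigma> t < u \<Longrightarrow> u < t \<Longrightarrow> z' u \<le> \<beta> u * (G1 - z u)"
    and G2: "\<And>u. t - \<sigma> t < u \<Longrightarrow> u < t \<Longrightarrow> - V / 2 \<le> z (u - \<sigma> u) \<Longrightarrow> z' u \<le> \<beta> u * (G2 - z u)"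
    and hit: "z t = V" "z (t - \<sigma> t) \<le> 0"
    and pos: "0 < V" "0 \<le> C" "0 \<le> G1"
    and c: "0 \<le> c" "c \<le> \<xi>" "c * C \<le> 1 / 2"
    and g: "(1 - exp (- (\<xi> - c))) * G1 < V"
      "exp (- c) * ((1 - exp (- (\<xi> - c))) * G1) + (1 - exp (- c)) * G2 < V"
  shows False
proof -
  \<comment> \<open>\<open>h\<close> bounds what \<open>z\<close> can gain under \<open>G1\<close>,
    starting from a zero, during \<open>B\<close>-time \<open>\<xi> - c\<close>.\<close>
  define h where "h = (1 - exp (- (\<xi> - c))) * G1"
  let ?s = "t - \<sigma> t"
  have s: "a \<le> ?s" "?s \<le> t" "B t - B ?s \<le> \<xi>" using \<sigma>[of t] \<sigma>t by auto
  have sub: "continuous_on {p..q} z" "continuous_on {p..q} B" if "a \<le> p" "q \<le> t" for p q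
    using cont that by (auto elim: continuous_on_subset)
  have Bmono: "B p \<le> B q" if "a \<le> p" "p \<le> q" "q \<le> t" for p q
  proof (rule DERIV_nonneg_imp_increasing_open[OF that(2)])
    show "\<exists>y. DERIV B u :> y \<and> 0 \<le> y" if "p < u" "u < q" for u
      using B[of u] \<beta>[of u] that \<open>a \<le> p\<close> \<open>q \<le> t\<close> by force
  qed (use sub that in blast)
  have zlip: "z q - z p \<le> C * V * (B q - B p)" if "a \<le> p" "p \<le> q" "q \<le> t" for p q
  proof -
    have "z q - C * V * B q \<le> z p - C * V * B p"
    proof (rule DERIV_nonpos_imp_decreasing_open[OF that(2)])
      fix u assume u: "p < u" "u < q"
      then have u': "a < u" "u < t" using that by auto
      have "DERIV (\<lambda>u. z u - C * V * B u) u :> z' u - C * V * \<beta> u"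
        by (rule derivative_eq_intros z[OF u'] B[OF u'] refl | simp)+
      then show "\<exists>y. DERIV (\<lambda>u. z u - C * V * B u) u :> y \<and> y \<le> 0"
        using lip[OF u'] by (intro exI[of _ "z' u - C * V * \<beta> u"]) (simp add: mult.commute)
    qed (intro continuous_intros sub that)
    then show ?thesis by (simp add: algebra_simps)
  qed
  obtain s1 where s1: "?s \<le> s1" "s1 < t" "z s1 = 0" "\<And>u. s1 < u \<Longrightarrow> u \<le> t \<Longrightarrow> 0 < z u"
    using last_zero[of ?s t z] s sub[of ?s t] hit pos by auto
  have as1: "a \<le> s1" using s s1 by simp
  have up1: "z q \<le> G1 - G1 * exp (- (B q - B s1))" if "s1 \<le> q" "q \<le> t" for q
    using exp_comparison[of s1 q z B z' \<beta> G1] sub[of s1 q] z B G1 that s1 as1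
    by simp
  have B1: "B t - B s1 \<le> \<xi>" using Bmono[of ?s s1] s s1 by simp
  have up1': "z q \<le> h" if "s1 \<le> q" "q \<le> t" "B q - B s1 \<le> \<xi> - c" for q
  proof -
    have "exp (- (\<xi> - c)) \<le> exp (- (B q - B s1))" using that by simp
    then have "G1 * exp (- (\<xi> - c)) \<le> G1 * exp (- (B q - B s1))" using pos by (intro mult_left_mono)
    then show ?thesis using up1[OF that(1,2)] by (simp add: h_def algebra_simps)
  qed
  show False
  proof (cases "B t - B s1 \<le> \<xi> - c")
    case True
    then show False using up1'[of t] s1 g hit by (simp add: h_def)
  next
    case False
    \<comment> \<open>At \<open>s2\<close> exactly \<open>\<xi> - c\<close> of \<open>B\<close>-time
      has passed since the last zero, so at most \<open>c\<close> remains until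
      \<open>t\<close>.\<close>
    obtain s2 where s2: "s1 \<le> s2" "s2 \<le> t" "B s2 = B s1 + (\<xi> - c)"
      using IVT'[of B s1 "B s1 + (\<xi> - c)" t] False c s1 sub[of s1 t] as1 by auto
    have zs2: "z s2 \<le> h" using up1'[of s2] s2 by simp
    have G2': "z' u \<le> \<beta> u * (G2 - z u)" if u: "s2 < u" "u < t" for u
    proof (rule G2)
      show "?s < u" "u < t" using u s1 s2 by auto
      let ?v = "u - \<sigma> u"
      have v: "a \<le> ?v" "?v \<le> u" "B u - B ?v \<le> \<xi>" using \<sigma>[of u] u s1 s2 by auto
      show "- V / 2 \<le> z ?v"
      proof (cases "s1 \<le> ?v")
        case True
        then have "0 \<le> z ?v" using s1(3) s1(4)[of ?v] v u by (cases "s1 = ?v") auto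
        then show ?thesis using pos by simp
      next
        case False
        have "B s2 \<le> B u" using Bmono[of s2 u] u s2 as1 by simp
        then have "B s1 - B ?v \<le> c" using v s2 by simp
        then have "C * V * (B s1 - B ?v) \<le> C * V * c" using pos by (intro mult_left_mono) auto
        moreover have "C * V * c \<le> V / 2" using mult_right_mono[OF c(3), of V] pos by (simp add: algebra_simps)
        moreover have "- z ?v \<le> C * V * (B s1 - B ?v)" using zlip[of ?v s1] False v s1 by simp
        ultimately show ?thesis by simp
      qed
    qed
    define e where "e = exp (- (B t - B s2))"
    have "exp (- c) \<le> e" unfolding e_def using B1 s2 by simp
    have "e \<le> 1" unfolding e_def using Bmono[of s2 t] s2 as1 by simp
    have "V \<le> G2 + (z s2 - G2) * e"
      using exp_comparison[of s2 t z B z' \<beta> G2] sub[of s2 t] z B G2' s2 as1 hit by (simp add: e_def)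
    also have "\<dots> \<le> G2 + (h - G2) * e" using zs2 by (simp add: e_def)
    \<comment> \<open>The expression is affine in \<open>e\<close>, which lies between
      \<open>exp (- c)\<close> and \<open>1\<close>; the two hypotheses \<open>g\<close> treat these
      two endpoints.\<close>
    also have "\<dots> < V"
    proof (cases "h \<le> G2")
      case True
      then have "(h - G2) * e \<le> (h - G2) * exp (- c)"
        using \<open>exp (- c) \<le> e\<close> by (intro mult_left_mono_neg) auto
      then show ?thesis using g(2) unfolding h_def[symmetric] by (simp add: algebra_simps)
    next
      case False
      then have "(h - G2) * e \<le> (h - G2) * 1" using \<open>e \<le> 1\<close> by (intro mult_left_mono) auto
      then show ?thesis using g(1) unfolding h_def[symmetric] by simp
    qed
    finally show False by simp
  qed
qed

section \<open>The rescaled equation and its clock\<close>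

text \<open>In terms of the original data, \<open>K\<close> stands for \<open>a * K\<close>,
  \<open>\<beta>\<close> for \<open>\<delta> * \<beta>\<close>, \<open>\<zeta>\<close> for
  \<open>\<delta> * \<zeta>\<close> and the unknown for \<open>a * x\<close>. The antiderivative
  \<open>B\<close> of \<open>\<beta>\<close> acts as a clock: integrals over
  \<open>{t - \<sigma> t..t}\<close> become increments of \<open>B\<close>, and the upper limit is
  expressed by the eventual bound \<open>B_delay\<close>.\<close>

locale normalized_nicholson =
  fixes t0 r K \<zeta> b0 b1 :: real and \<beta> \<sigma> \<tau> B :: "real \<Rightarrow> real"
  assumes K_pos: "0 < K" and \<zeta>_nonneg: "0 \<le> \<zeta>" and K_\<zeta>: "K * (exp \<zeta> - 1) \<le> 1"
    and b0_pos: "0 < b0"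
    and \<beta>: "\<And>t. t0 \<le> t \<Longrightarrow> b0 \<le> \<beta> t \<and> \<beta> t \<le> b1"
    and \<sigma>: "\<And>t. t0 \<le> t \<Longrightarrow> 0 \<le> \<sigma> t \<and> \<sigma> t \<le> r"
    and \<tau>: "\<And>t. t0 \<le> t \<Longrightarrow> 0 \<le> \<tau> t \<and> \<tau> t \<le> r"
    and B_deriv: "\<And>t. t0 \<le> t \<Longrightarrow> (B has_real_derivative \<beta> t) (at t within {t0..})"
    and B_delay: "\<And>\<epsilon>. 0 < \<epsilon> \<Longrightarrow> \<forall>\<^sub>F t in at_top. B t - B (t - \<sigma> t) \<le> \<zeta> + \<epsilon>"
begin

lemma r_nonneg: "0 \<le> r" using \<sigma>[of t0] by simp

lemma b1_pos: "0 < b1" using \<beta>[of t0] b0_pos by simp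

lemma B_continuous: "t0 \<le> s \<Longrightarrow> continuous_on {s..t} B"
  by (rule continuous_on_subset[of "{t0..}"], rule DERIV_continuous_on, rule B_deriv) auto

lemma B_DERIV: "t0 < t \<Longrightarrow> DERIV B t :> \<beta> t"
  using B_deriv[of t] at_within_interior[of t "{t0..}"] by simp

lemma B_mono: "B s \<le> B t" if "t0 \<le> s" "s \<le> t"
proof (rule DERIV_nonneg_imp_increasing_open[OF that(2)])
  show "\<exists>y. DERIV B u :> y \<and> 0 \<le> y" if "s < u" "u < t" for u
    using B_DERIV[of u] \<beta>[of u] b0_pos that \<open>t0 \<le> s\<close> by (intro exI[of _ "\<beta> u"]) auto
qed (use B_continuous that in blast)

lemma B_lipschitz: "B t - B s \<le> b1 * (t - s)" if "t0 \<le> s" "s \<le> t"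
proof -
  have "B t - b1 * t \<le> B s - b1 * s"
  proof (rule DERIV_nonpos_imp_decreasing_open[OF that(2)])
    fix u assume u: "s < u" "u < t"
    have "DERIV (\<lambda>u. B u - b1 * u) u :> \<beta> u - b1"
      using u that by (auto intro!: derivative_eq_intros B_DERIV)
    then show "\<exists>y. DERIV (\<lambda>u. B u - b1 * u) u :> y \<and> y \<le> 0"
      using \<beta>[of u] u that by (intro exI[of _ "\<beta> u - b1"]) auto
  qed (intro continuous_intros B_continuous that)
  then show ?thesis by (simp add: algebra_simps)
qed

lemma K_weight: "K * (1 - exp (- \<zeta>)) \<le> exp (- \<zeta>)"
proof -
  have "K * (exp \<zeta> - 1) * exp (- \<zeta>) \<le> 1 * exp (- \<zeta>)"
    using K_\<zeta> by (rule mult_right_mono) simp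
  then show ?thesis by (simp add: algebra_simps mult_exp_exp)
qed

text \<open>Rate of change in \<open>B\<close>-time per unit of deviation from \<open>K\<close>:
  \<open>exp K\<close> comes from the factor \<open>x (t - \<tau> t)\<close>,
  \<open>K * exp K\<close> from the exponential and \<open>1\<close> from the undelayed
  term.\<close>

definition Lip :: real where
  "Lip = exp K * (1 + K) + 1"

lemma Lip_ge: "2 \<le> Lip"
proof -
  have "1 * 1 \<le> exp K * (1 + K)" using K_pos by (intro mult_mono) auto
  then show ?thesis by (simp add: Lip_def)
qed

end

section \<open>Positivity and comparison estimates for a solution\<close>

locale normalized_solution = normalized_nicholson +
  fixes x :: "real \<Rightarrow> real"
  assumes x_initial: "\<And>t. t0 - r \<le> t \<Longrightarrow> t \<le> t0 \<Longrightarrow> 0 \<le> x t" and x_t0: "0 < x t0"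
    and x_deriv: "\<And>t. t0 \<le> t \<Longrightarrow>
      (x has_real_derivative \<beta> t * (x (t - \<tau> t) * exp (K - x (t - \<sigma> t)) - x t)) (at t within {t0..})"
begin

definition dx :: "real \<Rightarrow> real" where
  "dx t = \<beta> t * (x (t - \<tau> t) * exp (K - x (t - \<sigma> t)) - x t)"

lemma x_continuous: "t0 \<le> s \<Longrightarrow> continuous_on {s..t} x"
  by (rule continuous_on_subset[of "{t0..}"], rule DERIV_continuous_on, rule x_deriv) auto

lemma x_DERIV: "t0 < t \<Longrightarrow> DERIV x t :> dx t"
  using x_deriv[of t] at_within_interior[of t "{t0..}"] by (simp add: dx_def)

lemma upper_comparison:
  assumes "t0 \<le> s" "s \<le> t"
    and "\<And>u. s < u \<Longrightarrow> u < t \<Longrightarrow> x (u - \<tau> u) * exp (K - x (u - \<sigma> u)) \<le> C"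
  shows "x t \<le> C + (x s - C) * exp (- (B t - B s))"
proof (rule exp_comparison[OF assms(2)])
  fix u assume u: "s < u" "u < t"
  then have u0: "t0 < u" using assms by simp
  show "DERIV x u :> dx u" "DERIV B u :> \<beta> u" using x_DERIV B_DERIV u0 by auto
  show "dx u \<le> \<beta> u * (C - x u)"
    unfolding dx_def using assms(3)[OF u] \<beta>[of u] b0_pos u0 by (intro mult_left_mono) auto
qed (intro x_continuous B_continuous assms)+

lemma lower_comparison:
  assumes "t0 \<le> s" "s \<le> t"
    and "\<And>u. s < u \<Longrightarrow> u < t \<Longrightarrow> C \<le> x (u - \<tau> u) * exp (K - x (u - \<sigma> u))"
  shows "C + (x s - C) * exp (- (B t - B s)) \<le> x t"
proof -
  have "- x t \<le> - C + (- x s - (- C)) * exp (- (B t - B s))"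
  proof (rule exp_comparison[OF assms(2)])
    fix u assume u: "s < u" "u < t"
    then have u0: "t0 < u" using assms by simp
    show "DERIV (\<lambda>t. - x t) u :> - dx u" "DERIV B u :> \<beta> u"
      using DERIV_minus[OF x_DERIV] B_DERIV u0 by auto
    have "\<beta> u * (C - x u) \<le> dx u"
      unfolding dx_def using assms(3)[OF u] \<beta>[of u] b0_pos u0 by (intro mult_left_mono) auto
    then show "- dx u \<le> \<beta> u * (- C - - x u)" by (simp add: algebra_simps)
  qed (intro continuous_intros x_continuous B_continuous assms)+
  then show ?thesis by (simp add: algebra_simps)
qed

text \<open>Up to a first zero the production term is nonnegative, so comparison with
  \<open>C = 0\<close> keeps \<open>x\<close> above an exponentially decayed multiple of
  \<open>x t0\<close>.\<close>

lemma x_pos: "0 < x t" if t: "t0 \<le> t"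
proof (rule ccontr)
  assume "\<not> 0 < x t"
  moreover have "continuous_on {t0..t} (\<lambda>u. - x u)"
    by (intro continuous_intros x_continuous) simp
  ultimately obtain s where "t0 < s" "s \<le> t" "- x s = 0"
      "\<And>u. t0 \<le> u \<Longrightarrow> u < s \<Longrightarrow> - x u < 0"
    using t x_t0 by - (rule first_hitting_time[of t0 t "\<lambda>u. - x u" 0], auto)
  then have s: "t0 < s" "x s = 0" "\<And>u. t0 \<le> u \<Longrightarrow> u < s \<Longrightarrow> 0 < x u" by auto
  have "0 + (x t0 - 0) * exp (- (B s - B t0)) \<le> x s"
  proof (rule lower_comparison)
    fix u assume u: "t0 < u" "u < s"
    then have "0 \<le> x (u - \<tau> u)"
      using s(3)[of "u - \<tau> u"] x_initial[of "u - \<tau> u"] \<tau>[of u] by (cases "t0 \<le> u - \<tau> u") auto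
    then show "0 \<le> x (u - \<tau> u) * exp (K - x (u - \<sigma> u))" by simp
  qed (use s in auto)
  then show False using s x_t0 by (simp add: mult_le_0_iff)
qed

lemma x_nonneg: "t0 - r \<le> t \<Longrightarrow> 0 \<le> x t"
  using x_pos[of t] x_initial[of t] by (cases "t0 \<le> t") auto

lemma x_decay: "x s * exp (- (B t - B s)) \<le> x t" if "t0 \<le> s" "s \<le> t"
proof -
  have "0 + (x s - 0) * exp (- (B t - B s)) \<le> x t"
  proof (rule lower_comparison[OF that])
    fix u assume "s < u"
    then have "0 \<le> x (u - \<tau> u)" using \<tau>[of u] that by (intro x_nonneg) auto
    then show "0 \<le> x (u - \<tau> u) * exp (K - x (u - \<sigma> u))" by simp
  qed
  then show ?thesis by simp
qed

text \<open>The lower bound \<open>b0\<close> on \<open>\<beta>\<close> converts a nearly vanishing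
  derivative into near balance of production and loss. This lemma and its mirror image
  \<open>dx_ge_imp\<close> are applied at extrema and at the near-extremal times supplied by
  \<open>fluctuation\<close>.\<close>

lemma dx_le_imp:
  assumes "t0 \<le> t" "dx t \<le> \<epsilon>" "0 \<le> \<epsilon>"
  shows "x (t - \<tau> t) * exp (K - x (t - \<sigma> t)) \<le> x t + \<epsilon> / b0"
proof (rule ccontr)
  let ?d = "x (t - \<tau> t) * exp (K - x (t - \<sigma> t)) - x t"
  assume "\<not> ?thesis"
  then have d: "\<epsilon> / b0 < ?d" by simp
  then have "0 < ?d" using assms b0_pos by (smt (verit) divide_nonneg_pos)
  have "\<epsilon> < b0 * ?d" using d b0_pos by (simp add: field_simps)
  also have "\<dots> \<le> dx t" unfolding dx_def using \<beta>[OF assms(1)] \<open>0 < ?d\<close> by (intro mult_right_mono) auto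
  finally show False using assms by simp
qed

lemma dx_ge_imp:
  assumes "t0 \<le> t" "- \<epsilon> \<le> dx t" "0 \<le> \<epsilon>"
  shows "x t - \<epsilon> / b0 \<le> x (t - \<tau> t) * exp (K - x (t - \<sigma> t))"
proof (rule ccontr)
  let ?d = "x t - x (t - \<tau> t) * exp (K - x (t - \<sigma> t))"
  assume "\<not> ?thesis"
  then have d: "\<epsilon> / b0 < ?d" by simp
  then have "0 < ?d" using assms b0_pos by (smt (verit) divide_nonneg_pos)
  have "\<epsilon> < b0 * ?d" using d b0_pos by (simp add: field_simps)
  also have "\<dots> \<le> \<beta> t * ?d" using \<beta>[OF assms(1)] \<open>0 < ?d\<close> by (intro mult_right_mono) auto
  also have "\<dots> = - dx t" by (simp add: dx_def algebra_simps)
  finally show False using assms by simp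
qed

section \<open>Permanence, asymptotic estimates and global attractivity\<close>

text \<open>At a new minimum \<open>s\<close> the derivative is nonpositive and
  \<open>x (s - \<tau> s)\<close> is no smaller than \<open>x s\<close>, so the exponential factor
  is at most \<open>1\<close> and \<open>x (s - \<sigma> s) \<ge> K\<close>. From there
  \<open>x\<close> decays at most by the factor \<open>exp (- (b1 * r))\<close>.\<close>

lemma bounded_away_from_0:
  obtains m where "0 < m" "m \<le> K" "\<And>t. t0 \<le> t \<Longrightarrow> m \<le> x t"
proof -
  obtain v where v: "t0 \<le> v" "v \<le> t0 + r" "\<And>u. t0 \<le> u \<Longrightarrow> u \<le> t0 + r \<Longrightarrow> x v \<le> x u"
    using continuous_attains_inf[of "{t0..t0+r}" x] x_continuous[of t0] r_nonneg by auto
  \<comment> \<open>The first term covers the times up to \<open>t0 + r\<close>, when delayed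
    arguments may still precede \<open>t0\<close>.\<close>
  define m where "m = min (x v) (K * exp (- (b1 * r)))"
  show ?thesis
  proof
    show "0 < m" using x_pos[of v] v K_pos by (simp add: m_def)
    have "K * exp (- (b1 * r)) \<le> K * 1" using K_pos b1_pos r_nonneg by (intro mult_left_mono) auto
    then show "m \<le> K" by (simp add: m_def)
    show "m \<le> x t" if t: "t0 \<le> t" for t
    proof (rule ccontr)
      assume "\<not> m \<le> x t"
      obtain s where s: "t0 \<le> s" "s \<le> t" "\<And>u. t0 \<le> u \<Longrightarrow> u \<le> t \<Longrightarrow> x s \<le> x u"
        using continuous_attains_inf[of "{t0..t}" x] x_continuous[of t0] t by auto
      have xs: "x s < m" using s(3)[of t] t \<open>\<not> m \<le> x t\<close> by simp
      then have sr: "t0 + r < s" using v(3)[of s] s by (force simp: m_def)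
      then have "t0 < s" using r_nonneg by simp
      have "0 \<le> - dx s"
        by (rule DERIV_nonneg_at_left_max[OF DERIV_minus[OF x_DERIV[OF \<open>t0 < s\<close>]] \<open>t0 < s\<close>])
          (use s in auto)
      then have le: "x (s - \<tau> s) * exp (K - x (s - \<sigma> s)) \<le> x s"
        using dx_le_imp[of s 0] s by simp
      have "x s * exp (K - x (s - \<sigma> s)) \<le> x (s - \<tau> s) * exp (K - x (s - \<sigma> s))"
        using s(3)[of "s - \<tau> s"] \<tau>[of s] sr s by (intro mult_right_mono) auto
      then have "x s * exp (K - x (s - \<sigma> s)) \<le> x s * 1" using le by linarith
      then have "K \<le> x (s - \<sigma> s)" using x_pos[OF s(1)] by simp
      have ss: "t0 \<le> s - \<sigma> s" "s - \<sigma> s \<le> s" using \<sigma>[of s] sr s by auto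
      have "B s - B (s - \<sigma> s) \<le> b1 * \<sigma> s" using B_lipschitz[OF ss] by simp
      also have "\<dots> \<le> b1 * r" using \<sigma>[of s] s b1_pos by simp
      finally have "exp (- (b1 * r)) \<le> exp (- (B s - B (s - \<sigma> s)))" by simp
      then have "K * exp (- (b1 * r)) \<le> x (s - \<sigma> s) * exp (- (B s - B (s - \<sigma> s)))"
        using \<open>K \<le> x (s - \<sigma> s)\<close> K_pos by (intro mult_mono) auto
      also have "\<dots> \<le> x s" by (rule x_decay[OF ss])
      finally show False using xs by (simp add: m_def)
    qed
  qed
qed

text \<open>Two delays get chained: for \<open>u\<close> in \<open>{t - \<sigma> t..t}\<close> the
  equation looks back to \<open>u - \<tau> u\<close> and \<open>u - \<sigma> u\<close>, whence the
  reach \<open>2 * r\<close>.\<close>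

lemma eventually_delayed:
  assumes "\<forall>\<^sub>F t in at_top. P t"
  shows "\<forall>\<^sub>F t in at_top. \<forall>u. t - 2 * r \<le> u \<longrightarrow> P u"
proof -
  obtain T where "\<And>t. T \<le> t \<Longrightarrow> P t" using assms by (auto simp: eventually_at_top_linorder)
  then show ?thesis by (auto simp: eventually_at_top_linorder intro!: exI[of _ "T + 2 * r"])
qed

text \<open>At a late time with \<open>x t\<close> near \<open>l\<close> and derivative at most
  \<open>\<epsilon>\<close>, near balance forces \<open>x (t - \<sigma> t)\<close> to be almost at
  least \<open>K\<close>. Comparison over \<open>{t - \<sigma> t..t}\<close> with production at
  least about \<open>l * \<kappa>\<close> gives the claim as \<open>\<epsilon>\<close> tends to
  \<open>0\<close>. The bound \<open>\<kappa>\<close> is first \<open>0\<close>, and then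
  \<open>exp (K - L)\<close> once \<open>L\<close> is available.\<close>

lemma liminf_estimate:
  assumes "0 < l" "l \<le> K" "0 \<le> \<kappa>" "\<kappa> \<le> 1"
    and ev_l: "\<And>\<epsilon>. 0 < \<epsilon> \<Longrightarrow> \<forall>\<^sub>F t in at_top. l - \<epsilon> \<le> x t"
    and freq: "\<And>\<epsilon> S. l < K \<Longrightarrow> 0 < \<epsilon> \<Longrightarrow> \<exists>t\<ge>S. x t < l + \<epsilon>"
    and ev_\<kappa>: "\<And>\<epsilon>. 0 < \<epsilon> \<Longrightarrow> \<forall>\<^sub>F t in at_top. \<kappa> - \<epsilon> \<le> exp (K - x t)"
  shows "exp (- \<zeta>) * K + (1 - exp (- \<zeta>)) * (l * \<kappa>) \<le> l"
proof (cases "l = K")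
  \<comment> \<open>At the cap \<open>freq\<close> gives nothing, but
    \<open>\<kappa> \<le> 1\<close> suffices.\<close>
  case True
  have "K * \<kappa> \<le> K * 1" using assms K_pos by (intro mult_left_mono) auto
  then have "(1 - exp (- \<zeta>)) * (K * \<kappa>) \<le> (1 - exp (- \<zeta>)) * K"
    using \<zeta>_nonneg by (intro mult_left_mono) auto
  then show ?thesis using True by (simp add: algebra_simps)
next
  case False
  then have "l < K" using assms by simp
  \<comment> \<open>As \<open>\<epsilon>\<close> tends to \<open>0\<close> these tend to
    \<open>exp (- \<zeta>)\<close>, \<open>K\<close> and \<open>l * \<kappa>\<close>; the term
    \<open>\<epsilon> / b0\<close> is the balance error from \<open>dx_le_imp\<close>.\<close>
  define W X D where "W \<epsilon> = exp (- (\<zeta> + \<epsilon>))"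
    and "X \<epsilon> = K - ln ((l + \<epsilon> + \<epsilon> / b0) / (l - \<epsilon>))" and "D \<epsilon> = (l - \<epsilon>) * (\<kappa> - \<epsilon>)" for \<epsilon> :: real
  have est: "W \<epsilon> * X \<epsilon> + (1 - W \<epsilon>) * min (D \<epsilon>) (X \<epsilon>) \<le> l + \<epsilon>" if \<epsilon>: "0 < \<epsilon>" "\<epsilon> < l" for \<epsilon>
  proof -
    have "\<forall>\<^sub>F t in at_top. \<forall>u. t - 2 * r \<le> u \<longrightarrow> l - \<epsilon> \<le> x u \<and> \<kappa> - \<epsilon> \<le> exp (K - x u)"
      by (intro eventually_delayed eventually_conj ev_l ev_\<kappa> \<epsilon>)
    with B_delay[OF \<epsilon>(1)] eventually_gt_at_top[of "t0 + 2 * r"]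
    have "\<forall>\<^sub>F t in at_top. t0 + 2 * r < t \<and> B t - B (t - \<sigma> t) \<le> \<zeta> + \<epsilon> \<and>
        (\<forall>u. t - 2 * r \<le> u \<longrightarrow> l - \<epsilon> \<le> x u \<and> \<kappa> - \<epsilon> \<le> exp (K - x u))"
      by eventually_elim auto
    then obtain T where T: "\<And>t. T \<le> t \<Longrightarrow> t0 + 2 * r < t \<and> B t - B (t - \<sigma> t) \<le> \<zeta> + \<epsilon> \<and>
        (\<forall>u. t - 2 * r \<le> u \<longrightarrow> l - \<epsilon> \<le> x u \<and> \<kappa> - \<epsilon> \<le> exp (K - x u))"
      by (auto simp: eventually_at_top_linorder)
    have "\<exists>t\<ge>T. - (l + \<epsilon>) < - x t \<and> - \<epsilon> \<le> - dx t"
    proof (rule fluctuation)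
      show "DERIV (\<lambda>t. - x t) t :> - dx t" if "T \<le> t" for t
        using T[OF that] r_nonneg by (intro DERIV_minus x_DERIV) auto
      show "\<exists>t\<ge>S. - (l + \<epsilon>) < - x t" for S
        using freq[OF \<open>l < K\<close> \<epsilon>(1), of S] by auto
    qed fact
    then obtain t where t: "T \<le> t" "x t < l + \<epsilon>" "dx t \<le> \<epsilon>" by auto
    have t0: "t0 + 2 * r < t" and Bt: "B t - B (t - \<sigma> t) \<le> \<zeta> + \<epsilon>"
      and past: "\<And>u. t - 2 * r \<le> u \<Longrightarrow> l - \<epsilon> \<le> x u" "\<And>u. t - 2 * r \<le> u \<Longrightarrow> \<kappa> - \<epsilon> \<le> exp (K - x u)"
      using T[OF t(1)] by auto
    let ?s = "t - \<sigma> t"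
    have t0': "t0 \<le> t" using t0 r_nonneg by simp
    have s: "t0 \<le> ?s" "?s \<le> t" "t - r \<le> ?s" using \<sigma>[OF t0'] t0 r_nonneg by auto
    have "(l - \<epsilon>) * exp (K - x ?s) \<le> x (t - \<tau> t) * exp (K - x ?s)"
      using past(1)[of "t - \<tau> t"] \<tau>[OF t0'] r_nonneg by (intro mult_right_mono) auto
    also have "\<dots> \<le> x t + \<epsilon> / b0" using dx_le_imp[OF t0' t(3)] \<epsilon> by simp
    also have "\<dots> \<le> l + \<epsilon> + \<epsilon> / b0" using t by simp
    finally have "exp (K - x ?s) \<le> (l + \<epsilon> + \<epsilon> / b0) / (l - \<epsilon>)"
      using \<epsilon> by (simp add: pos_le_divide_eq mult.commute)
    then have "K - x ?s \<le> ln ((l + \<epsilon> + \<epsilon> / b0) / (l - \<epsilon>))"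
      by (metis exp_gt_zero ln_exp ln_mono)
    then have Xs: "X \<epsilon> \<le> x ?s" by (simp add: X_def)
    define w where "w = exp (- (B t - B ?s))"
    have w: "W \<epsilon> \<le> w" "w \<le> 1" using Bt B_mono[OF s(1,2)] by (auto simp: W_def w_def)
    have "D \<epsilon> + (x ?s - D \<epsilon>) * w \<le> x t" unfolding w_def
    proof (rule lower_comparison[OF s(1,2)])
      fix u assume u: "?s < u" "u < t"
      then have "t0 \<le> u" using s by simp
      have p: "l - \<epsilon> \<le> x (u - \<tau> u)" "\<kappa> - \<epsilon> \<le> exp (K - x (u - \<sigma> u))"
        using u s \<tau>[OF \<open>t0 \<le> u\<close>] \<sigma>[OF \<open>t0 \<le> u\<close>] by (auto intro!: past)
      have "D \<epsilon> \<le> (l - \<epsilon>) * exp (K - x (u - \<sigma> u))"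
        unfolding D_def using p \<epsilon> by (intro mult_left_mono) auto
      also have "\<dots> \<le> x (u - \<tau> u) * exp (K - x (u - \<sigma> u))"
        using p by (intro mult_right_mono) auto
      finally show "D \<epsilon> \<le> x (u - \<tau> u) * exp (K - x (u - \<sigma> u))" .
    qed
    moreover have "w * X \<epsilon> \<le> w * x ?s" using Xs by (intro mult_left_mono) (auto simp: w_def)
    \<comment> \<open>The weight \<open>1 - W \<epsilon>\<close> splits into
      \<open>w - W \<epsilon>\<close> on \<open>X \<epsilon>\<close> and \<open>1 - w\<close> on
      \<open>D \<epsilon>\<close> in unknown proportion, hence the minimum. In the limit it equals
      \<open>l * \<kappa>\<close>, because \<open>\<kappa> \<le> 1\<close> and
      \<open>l < K\<close>.\<close>
    moreover have "(w - W \<epsilon>) * min (D \<epsilon>) (X \<epsilon>) \<le> (w - W \<epsilon>) * X \<epsilon>" using w by (intro mult_left_mono) auto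
    moreover have "(1 - w) * min (D \<epsilon>) (X \<epsilon>) \<le> (1 - w) * D \<epsilon>" using w by (intro mult_left_mono) auto
    ultimately show ?thesis using t(2) by (simp add: algebra_simps)
  qed
  have "((\<lambda>\<epsilon>. W \<epsilon> * X \<epsilon> + (1 - W \<epsilon>) * min (D \<epsilon>) (X \<epsilon>))
      \<longlongrightarrow> exp (- \<zeta>) * K + (1 - exp (- \<zeta>)) * min (l * \<kappa>) K) (at_right 0)"
    unfolding W_def X_def D_def using \<open>0 < l\<close> b0_pos
    by (auto intro!: tendsto_eq_intros)
  moreover have "((\<lambda>\<epsilon>. l + \<epsilon>) \<longlongrightarrow> l) (at_right 0)" by (auto intro!: tendsto_eq_intros)
  moreover have "\<forall>\<^sub>F \<epsilon> in at_right 0. W \<epsilon> * X \<epsilon> + (1 - W \<epsilon>) * min (D \<epsilon>) (X \<epsilon>) \<le> l + \<epsilon>"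
    using est \<open>0 < l\<close> by (auto simp: eventually_at_right_field)
  ultimately have "exp (- \<zeta>) * K + (1 - exp (- \<zeta>)) * min (l * \<kappa>) K \<le> l"
    by (intro tendsto_le[of "at_right (0::real)"]) auto
  moreover have "l * \<kappa> \<le> l * 1" using assms by (intro mult_left_mono) auto
  ultimately show ?thesis using \<open>l < K\<close> by (simp add: min_def)
qed

text \<open>Mirror image of \<open>liminf_estimate\<close>: near-maximal times force
  \<open>x (t - \<sigma> t)\<close> to be at most about \<open>K\<close>. A maximum replaces the
  minimum and tends to \<open>L * \<kappa>\<close>, because \<open>\<kappa> \<ge> 1\<close> and
  \<open>K < L\<close>.\<close>

lemma limsup_estimate:
  assumes "K \<le> L" "1 \<le> \<kappa>"
    and ev_L: "\<And>\<epsilon>. 0 < \<epsilon> \<Longrightarrow> \<forall>\<^sub>F t in at_top. x t \<le> L + \<epsilon>"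
    and freq: "\<And>\<epsilon> S. K < L \<Longrightarrow> 0 < \<epsilon> \<Longrightarrow> \<exists>t\<ge>S. L - \<epsilon> < x t"
    and ev_\<kappa>: "\<And>\<epsilon>. 0 < \<epsilon> \<Longrightarrow> \<forall>\<^sub>F t in at_top. exp (K - x t) \<le> \<kappa> + \<epsilon>"
  shows "L \<le> exp (- \<zeta>) * K + (1 - exp (- \<zeta>)) * (L * \<kappa>)"
proof (cases "L = K")
  case True
  have "K * 1 \<le> K * \<kappa>" using assms K_pos by (intro mult_left_mono) auto
  then have "(1 - exp (- \<zeta>)) * K \<le> (1 - exp (- \<zeta>)) * (K * \<kappa>)"
    using \<zeta>_nonneg by (intro mult_left_mono) auto
  then show ?thesis using True by (simp add: algebra_simps)
next
  case False
  then have "K < L" using assms by simp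
  then have "0 < L" using K_pos by simp
  define W X D where "W \<epsilon> = exp (- (\<zeta> + \<epsilon>))"
    and "X \<epsilon> = K + ln ((L + \<epsilon>) / (L - \<epsilon> - \<epsilon> / b0))" and "D \<epsilon> = (L + \<epsilon>) * (\<kappa> + \<epsilon>)" for \<epsilon> :: real
  have est: "L - \<epsilon> \<le> W \<epsilon> * X \<epsilon> + (1 - W \<epsilon>) * max (D \<epsilon>) (X \<epsilon>)"
    if \<epsilon>: "0 < \<epsilon>" "0 < L - \<epsilon> - \<epsilon> / b0" for \<epsilon>
  proof -
    have "\<forall>\<^sub>F t in at_top. \<forall>u. t - 2 * r \<le> u \<longrightarrow> x u \<le> L + \<epsilon> \<and> exp (K - x u) \<le> \<kappa> + \<epsilon>"
      by (intro eventually_delayed eventually_conj ev_L ev_\<kappa> \<epsilon>)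
    with B_delay[OF \<epsilon>(1)] eventually_gt_at_top[of "t0 + 2 * r"]
    have "\<forall>\<^sub>F t in at_top. t0 + 2 * r < t \<and> B t - B (t - \<sigma> t) \<le> \<zeta> + \<epsilon> \<and>
        (\<forall>u. t - 2 * r \<le> u \<longrightarrow> x u \<le> L + \<epsilon> \<and> exp (K - x u) \<le> \<kappa> + \<epsilon>)"
      by eventually_elim auto
    then obtain T where T: "\<And>t. T \<le> t \<Longrightarrow> t0 + 2 * r < t \<and> B t - B (t - \<sigma> t) \<le> \<zeta> + \<epsilon> \<and>
        (\<forall>u. t - 2 * r \<le> u \<longrightarrow> x u \<le> L + \<epsilon> \<and> exp (K - x u) \<le> \<kappa> + \<epsilon>)"
      by (auto simp: eventually_at_top_linorder)
    have "\<exists>t\<ge>T. L - \<epsilon> < x t \<and> - \<epsilon> \<le> dx t"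
    proof (rule fluctuation)
      show "DERIV x t :> dx t" if "T \<le> t" for t
        using T[OF that] r_nonneg by (intro x_DERIV) auto
      show "\<exists>t\<ge>S. L - \<epsilon> < x t" for S
        using freq[OF \<open>K < L\<close> \<epsilon>(1), of S] by auto
    qed fact
    then obtain t where t: "T \<le> t" "L - \<epsilon> < x t" "- \<epsilon> \<le> dx t" by auto
    have t0: "t0 + 2 * r < t" and Bt: "B t - B (t - \<sigma> t) \<le> \<zeta> + \<epsilon>"
      and past: "\<And>u. t - 2 * r \<le> u \<Longrightarrow> x u \<le> L + \<epsilon>" "\<And>u. t - 2 * r \<le> u \<Longrightarrow> exp (K - x u) \<le> \<kappa> + \<epsilon>"
      using T[OF t(1)] by auto
    let ?s = "t - \<sigma> t"
    have t0': "t0 \<le> t" using t0 r_nonneg by simp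
    have s: "t0 \<le> ?s" "?s \<le> t" "t - r \<le> ?s" using \<sigma>[OF t0'] t0 r_nonneg by auto
    have "L - \<epsilon> - \<epsilon> / b0 \<le> x t - \<epsilon> / b0" using t by simp
    also have "\<dots> \<le> x (t - \<tau> t) * exp (K - x ?s)" using dx_ge_imp[OF t0' t(3)] \<epsilon> by simp
    also have "\<dots> \<le> (L + \<epsilon>) * exp (K - x ?s)"
      using past(1)[of "t - \<tau> t"] \<tau>[OF t0'] r_nonneg by (intro mult_right_mono) auto
    finally have "exp (x ?s - K) \<le> (L + \<epsilon>) / (L - \<epsilon> - \<epsilon> / b0)"
      using \<epsilon> by (simp add: pos_le_divide_eq exp_diff field_simps)
    then have "x ?s - K \<le> ln ((L + \<epsilon>) / (L - \<epsilon> - \<epsilon> / b0))"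
      by (metis exp_gt_zero ln_exp ln_mono)
    then have Xs: "x ?s \<le> X \<epsilon>" by (simp add: X_def)
    define w where "w = exp (- (B t - B ?s))"
    have w: "W \<epsilon> \<le> w" "w \<le> 1" using Bt B_mono[OF s(1,2)] by (auto simp: W_def w_def)
    have "x t \<le> D \<epsilon> + (x ?s - D \<epsilon>) * w" unfolding w_def
    proof (rule upper_comparison[OF s(1,2)])
      fix u assume u: "?s < u" "u < t"
      then have "t0 \<le> u" using s by simp
      have p: "x (u - \<tau> u) \<le> L + \<epsilon>" "exp (K - x (u - \<sigma> u)) \<le> \<kappa> + \<epsilon>"
        using u s \<tau>[OF \<open>t0 \<le> u\<close>] \<sigma>[OF \<open>t0 \<le> u\<close>] by (auto intro!: past)
      then show "x (u - \<tau> u) * exp (K - x (u - \<sigma> u)) \<le> D \<epsilon>"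
        unfolding D_def using \<epsilon> \<open>0 < L\<close> by (intro mult_mono) auto
    qed
    moreover have "w * x ?s \<le> w * X \<epsilon>" using Xs by (intro mult_left_mono) (auto simp: w_def)
    moreover have "(w - W \<epsilon>) * X \<epsilon> \<le> (w - W \<epsilon>) * max (D \<epsilon>) (X \<epsilon>)" using w by (intro mult_left_mono) auto
    moreover have "(1 - w) * D \<epsilon> \<le> (1 - w) * max (D \<epsilon>) (X \<epsilon>)" using w by (intro mult_left_mono) auto
    ultimately show ?thesis using t(2) by (simp add: algebra_simps)
  qed
  have "((\<lambda>\<epsilon>. W \<epsilon> * X \<epsilon> + (1 - W \<epsilon>) * max (D \<epsilon>) (X \<epsilon>))
      \<longlongrightarrow> exp (- \<zeta>) * K + (1 - exp (- \<zeta>)) * max (L * \<kappa>) K) (at_right 0)"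
    unfolding W_def X_def D_def using \<open>0 < L\<close> b0_pos
    by (auto intro!: tendsto_eq_intros)
  moreover have "((\<lambda>\<epsilon>. L - \<epsilon>) \<longlongrightarrow> L) (at_right 0)" by (auto intro!: tendsto_eq_intros)
  moreover have "\<forall>\<^sub>F \<epsilon> in at_right 0. L - \<epsilon> \<le> W \<epsilon> * X \<epsilon> + (1 - W \<epsilon>) * max (D \<epsilon>) (X \<epsilon>)"
  proof -
    have "((\<lambda>\<epsilon>. L - \<epsilon> - \<epsilon> / b0) \<longlongrightarrow> L) (at_right 0)"
      using b0_pos by (auto intro!: tendsto_eq_intros)
    then have "\<forall>\<^sub>F \<epsilon> in at_right 0. 0 < L - \<epsilon> - \<epsilon> / b0"
      using \<open>0 < L\<close> by (rule order_tendstoD)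
    moreover have "\<forall>\<^sub>F \<epsilon> in at_right (0::real). 0 < \<epsilon>" by (simp add: eventually_at_right_less)
    ultimately show ?thesis by eventually_elim (rule est)
  qed
  ultimately have "L \<le> exp (- \<zeta>) * K + (1 - exp (- \<zeta>)) * max (L * \<kappa>) K"
    by (intro tendsto_le[of "at_right (0::real)"]) auto
  moreover have "L * 1 \<le> L * \<kappa>" using assms \<open>0 < L\<close> by (intro mult_left_mono) auto
  ultimately show ?thesis using \<open>K < L\<close> by (simp add: max_def)
qed

text \<open>At a new maximum \<open>s\<close>, balance gives
  \<open>x (s - \<sigma> s) \<le> K\<close>, while the lower bound on \<open>x\<close> keeps every
  exponential factor at most \<open>E\<close>. Comparison yields
  \<open>x s \<le> x s * \<rho> \<epsilon> + K\<close>, and \<open>\<rho> \<epsilon> < 1\<close>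
  bounds \<open>x s\<close>.\<close>

lemma bounded_above:
  assumes ev: "\<And>\<epsilon>. 0 < \<epsilon> \<Longrightarrow> \<forall>\<^sub>F t in at_top. exp (- \<zeta>) * K - \<epsilon> \<le> x t"
  obtains M where "K \<le> M" "\<forall>\<^sub>F t in at_top. x t \<le> M"
proof -
  define \<rho> where "\<rho> \<epsilon> = exp (K - (exp (- \<zeta>) * K - \<epsilon>)) * (1 - exp (- (\<zeta> + \<epsilon>)))" for \<epsilon>
  \<comment> \<open>With \<open>w = exp (- \<zeta>)\<close>, \<open>K_weight\<close> says
    \<open>K * (1 - w) \<le> w\<close>, and \<open>1 - w < exp (- w)\<close>; the product is thus
    below \<open>exp w * exp (- w)\<close>. Strictness leaves room for
    \<open>\<epsilon>\<close>.\<close>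
  have "exp (K - exp (- \<zeta>) * K) * (1 - exp (- \<zeta>)) < 1"
  proof -
    have "exp (K - exp (- \<zeta>) * K) * (1 - exp (- \<zeta>)) \<le> exp (exp (- \<zeta>)) * (1 - exp (- \<zeta>))"
      using K_weight \<zeta>_nonneg by (intro mult_right_mono) (auto simp: algebra_simps)
    also have "\<dots> < exp (exp (- \<zeta>)) * exp (- exp (- \<zeta>))"
      using exp_minus_greater[of "exp (- \<zeta>)"] by (intro mult_strict_left_mono) auto
    also have "\<dots> = 1" by (simp add: mult_exp_exp)
    finally show ?thesis .
  qed
  moreover have "(\<rho> \<longlongrightarrow> exp (K - exp (- \<zeta>) * K) * (1 - exp (- \<zeta>))) (at_right 0)"
    unfolding \<rho>_def by (auto intro!: tendsto_eq_intros)
  ultimately have "\<forall>\<^sub>F \<epsilon> in at_right 0. \<rho> \<epsilon> < 1" by (simp add: order_tendstoD)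
  then obtain \<epsilon> where \<epsilon>: "0 < \<epsilon>" "\<rho> \<epsilon> < 1"
      using eventually_at_right_0_witness by blast
  define E where "E = exp (K - (exp (- \<zeta>) * K - \<epsilon>))"
  have E: "0 < E" "\<rho> \<epsilon> = E * (1 - exp (- (\<zeta> + \<epsilon>)))" by (auto simp: E_def \<rho>_def)
  have "\<forall>\<^sub>F t in at_top. t0 \<le> t \<and> B t - B (t - \<sigma> t) \<le> \<zeta> + \<epsilon> \<and> exp (- \<zeta>) * K - \<epsilon> \<le> x t"
    by (intro eventually_conj eventually_ge_at_top B_delay ev \<epsilon>)
  then obtain T where T: "\<And>t. T \<le> t \<Longrightarrow> t0 \<le> t \<and> B t - B (t - \<sigma> t) \<le> \<zeta> + \<epsilon> \<and> exp (- \<zeta>) * K - \<epsilon> \<le> x t"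
    by (auto simp: eventually_at_top_linorder)
  have "t0 \<le> T" using T by blast
  \<comment> \<open>Past this window of length \<open>2 * r\<close>, two consecutive delays still
    lead to times after \<open>T\<close>.\<close>
  obtain v where v: "T \<le> v" "v \<le> T + 2 * r" "\<And>u. T \<le> u \<Longrightarrow> u \<le> T + 2 * r \<Longrightarrow> x u \<le> x v"
    using continuous_attains_sup[of "{T..T + 2 * r}" x] x_continuous[OF \<open>t0 \<le> T\<close>] r_nonneg by auto
  define M where "M = Max {x v, K / (1 - \<rho> \<epsilon>), K}"
  have M: "x v \<le> M" "K / (1 - \<rho> \<epsilon>) \<le> M" "K \<le> M" by (auto simp: M_def)
  have "x t \<le> M" if t: "T \<le> t" for t
  proof (rule ccontr)
    assume "\<not> x t \<le> M"
    obtain s where s: "T \<le> s" "s \<le> t" "\<And>u. T \<le> u \<Longrightarrow> u \<le> t \<Longrightarrow> x u \<le> x s"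
      using continuous_attains_sup[of "{T..t}" x] x_continuous[OF \<open>t0 \<le> T\<close>] t by auto
    have xs: "M < x s" using s(3)[of t] t \<open>\<not> x t \<le> M\<close> by simp
    then have sr: "T + 2 * r < s" using v(3)[of s] s M(1) by force
    have "T < s" "t0 < s" "t0 \<le> s" using r_nonneg sr \<open>t0 \<le> T\<close> by auto
    have "0 \<le> dx s"
      by (rule DERIV_nonneg_at_left_max[OF x_DERIV[OF \<open>t0 < s\<close>] \<open>T < s\<close>]) (use s in auto)
    then have "x s * 1 \<le> x (s - \<tau> s) * exp (K - x (s - \<sigma> s))"
      using dx_ge_imp[of s 0] \<open>t0 \<le> s\<close> by simp
    also have "\<dots> \<le> x s * exp (K - x (s - \<sigma> s))"
      using s(3)[of "s - \<tau> s"] \<tau>[OF \<open>t0 \<le> s\<close>] sr s r_nonneg by (intro mult_right_mono) auto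
    finally have xK: "x (s - \<sigma> s) \<le> K" using x_pos[OF \<open>t0 \<le> s\<close>] by simp
    have ss: "t0 \<le> s - \<sigma> s" "s - \<sigma> s \<le> s" "T + r < s - \<sigma> s"
      using \<sigma>[OF \<open>t0 \<le> s\<close>] sr \<open>t0 \<le> T\<close> r_nonneg by auto
    define w where "w = exp (- (B s - B (s - \<sigma> s)))"
    have w: "exp (- (\<zeta> + \<epsilon>)) \<le> w" "0 < w" "w \<le> 1"
      using T[OF s(1)] B_mono[OF ss(1,2)] by (auto simp: w_def)
    have "x s \<le> x s * E + (x (s - \<sigma> s) - x s * E) * w"
      unfolding w_def
    proof (rule upper_comparison[OF ss(1,2)])
      fix u assume u: "s - \<sigma> s < u" "u < s"
      have "t0 \<le> u" using u ss by simp
      have uu: "T \<le> u - \<tau> u" "u - \<tau> u \<le> t" "T \<le> u - \<sigma> u"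
        using u ss s \<tau>[OF \<open>t0 \<le> u\<close>] \<sigma>[OF \<open>t0 \<le> u\<close>] by auto
      have "exp (K - x (u - \<sigma> u)) \<le> E" using T[OF uu(3)] by (simp add: E_def)
      then show "x (u - \<tau> u) * exp (K - x (u - \<sigma> u)) \<le> x s * E"
        using s(3)[OF uu(1,2)] x_pos[OF \<open>t0 \<le> s\<close>] by (intro mult_mono) auto
    qed
    also have "\<dots> = x s * E * (1 - w) + x (s - \<sigma> s) * w" by (simp add: algebra_simps)
    also have "\<dots> \<le> x s * E * (1 - exp (- (\<zeta> + \<epsilon>))) + K * 1"
      using w xK x_pos[OF \<open>t0 \<le> s\<close>] x_pos[OF ss(1)] E K_pos by (intro add_mono mult_mono) auto
    also have "\<dots> = x s * \<rho> \<epsilon> + K" by (simp add: E)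
    finally have "x s \<le> K / (1 - \<rho> \<epsilon>)" using \<epsilon> by (simp add: field_simps)
    then show False using xs M by simp
  qed
  then show ?thesis using that[of M] M by (auto simp: eventually_at_top_linorder)
qed

lemma attractive: "(x \<longlongrightarrow> K) at_top"
proof -
  obtain m where m: "0 < m" "m \<le> K" "\<And>t. t0 \<le> t \<Longrightarrow> m \<le> x t"
    using bounded_away_from_0 by blast
  have "\<forall>\<^sub>F t in at_top. m \<le> x t" using m(3) by (auto simp: eventually_at_top_linorder)
  then obtain l where l: "m \<le> l" "l \<le> K"
      "\<And>\<epsilon>. 0 < \<epsilon> \<Longrightarrow> \<forall>\<^sub>F t in at_top. l - \<epsilon> \<le> x t"
      "\<And>\<epsilon> S. l < K \<Longrightarrow> 0 < \<epsilon> \<Longrightarrow> \<exists>t\<ge>S. x t < l + \<epsilon>"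
    using truncated_liminf[OF m(2)] by blast
  have "0 < l" using m l by simp
  have "exp (- \<zeta>) * K + (1 - exp (- \<zeta>)) * (l * 0) \<le> l"
    by (rule liminf_estimate[OF \<open>0 < l\<close> l(2) _ _ l(3,4)])
      (auto intro!: always_eventually less_imp_le[OF less_trans[OF _ exp_gt_zero]])
  then have "\<forall>\<^sub>F t in at_top. exp (- \<zeta>) * K - \<epsilon> \<le> x t" if "0 < \<epsilon>" for \<epsilon>
    by (intro eventually_mono[OF l(3)[OF that]]) simp
  then obtain M where M: "K \<le> M" "\<forall>\<^sub>F t in at_top. x t \<le> M" using bounded_above by blast
  \<comment> \<open>\<open>truncated_liminf\<close> is applied to \<open>- x\<close> with cap
    \<open>- K\<close>, so that \<open>- L'\<close> is the upper limit truncated from below at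
    \<open>K\<close>.\<close>
  then have neg_M: "- M \<le> - K" "\<forall>\<^sub>F t in at_top. - M \<le> - x t" by auto
  then obtain L' where L': "- M \<le> L'" "L' \<le> - K"
      "\<And>\<epsilon>. 0 < \<epsilon> \<Longrightarrow> \<forall>\<^sub>F t in at_top. L' - \<epsilon> \<le> - x t"
      "\<And>\<epsilon> S. L' < - K \<Longrightarrow> 0 < \<epsilon> \<Longrightarrow> \<exists>t\<ge>S. - x t < L' + \<epsilon>"
    using truncated_liminf[OF neg_M] by blast
  define L where "L = - L'"
  have KL: "K \<le> L" using L' by (simp add: L_def)
  have ev_L: "\<forall>\<^sub>F t in at_top. x t \<le> L + \<epsilon>" if "0 < \<epsilon>" for \<epsilon>
    using L'(3)[OF that] by eventually_elim (simp add: L_def)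
  have fr_L: "\<exists>t\<ge>S. L - \<epsilon> < x t" if "K < L" "0 < \<epsilon>" for S \<epsilon>
    using L'(4)[of \<epsilon> S] that by (force simp: L_def)
  have "exp (- \<zeta>) * K + (1 - exp (- \<zeta>)) * (l * exp (K - L)) \<le> l"
  proof (rule liminf_estimate[OF \<open>0 < l\<close> l(2) _ _ l(3,4)])
    fix \<epsilon> :: real assume "0 < \<epsilon>"
    have "((\<lambda>\<eta>. exp (K - (L + \<eta>))) \<longlongrightarrow> exp (K - L)) (at_right 0)"
      by (auto intro!: tendsto_eq_intros)
    then have "\<forall>\<^sub>F \<eta> in at_right 0. exp (K - L) - \<epsilon> < exp (K - (L + \<eta>))"
      by (rule order_tendstoD) (use \<open>0 < \<epsilon>\<close> in simp)
    then obtain \<eta> where \<eta>: "0 < \<eta>" "exp (K - L) - \<epsilon> < exp (K - (L + \<eta>))"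
      using eventually_at_right_0_witness by blast
    show "\<forall>\<^sub>F t in at_top. exp (K - L) - \<epsilon> \<le> exp (K - x t)"
      using ev_L[OF \<eta>(1)] by eventually_elim (rule order_trans[OF less_imp_le[OF \<eta>(2)]], simp)
  qed (use KL in auto)
  moreover have "L \<le> exp (- \<zeta>) * K + (1 - exp (- \<zeta>)) * (L * exp (K - l))"
  proof (rule limsup_estimate[OF KL _ ev_L fr_L])
    fix \<epsilon> :: real assume "0 < \<epsilon>"
    have "((\<lambda>\<eta>. exp (K - (l - \<eta>))) \<longlongrightarrow> exp (K - l)) (at_right 0)"
      by (auto intro!: tendsto_eq_intros)
    then have "\<forall>\<^sub>F \<eta> in at_right 0. exp (K - (l - \<eta>)) < exp (K - l) + \<epsilon>"
      by (rule order_tendstoD) (use \<open>0 < \<epsilon>\<close> in simp)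
    then obtain \<eta> where \<eta>: "0 < \<eta>" "exp (K - (l - \<eta>)) < exp (K - l) + \<epsilon>"
      using eventually_at_right_0_witness by blast
    show "\<forall>\<^sub>F t in at_top. exp (K - x t) \<le> exp (K - l) + \<epsilon>"
      using l(3)[OF \<eta>(1)] by eventually_elim (rule order_trans[OF _ less_imp_le[OF \<eta>(2)]], simp)
  qed (use l in auto)
  ultimately have "l = K \<and> L = K"
    using K_weight \<zeta>_nonneg
    by (intro fluctuation_bounds_collapse[OF \<open>0 < l\<close> l(2) KL, of "exp (- \<zeta>)"]) auto
  then have ev: "\<forall>\<^sub>F t in at_top. K - \<epsilon> \<le> x t" "\<forall>\<^sub>F t in at_top. x t \<le> K + \<epsilon>" if "0 < \<epsilon>" for \<epsilon>
    using l(3) ev_L that by auto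
  show ?thesis
  proof (rule tendstoI)
    fix e :: real assume "0 < e"
    then have "\<forall>\<^sub>F t in at_top. K - e / 2 \<le> x t \<and> x t \<le> K + e / 2"
      by (intro eventually_conj ev) auto
    then show "\<forall>\<^sub>F t in at_top. dist (x t) K < e"
      by eventually_elim (use \<open>0 < e\<close> in \<open>auto simp: dist_real_def abs_less_iff\<close>)
  qed
qed

section \<open>Growth of deviations on bounded time intervals\<close>

text \<open>Production minus loss splits as
  \<open>?p * exp (- ?q) + K * (exp (- ?q) - 1) - (x t - K)\<close>. Nonnegativity of
  \<open>x\<close> means \<open>?q \<ge> - K\<close>, where \<open>exp K\<close> both bounds
  \<open>exp (- ?q)\<close> and is a Lipschitz constant for it.\<close>

lemma dx_lipschitz:
  assumes "t0 \<le> t" and V: "\<And>u. t - r \<le> u \<Longrightarrow> u \<le> t \<Longrightarrow> \<bar>x u - K\<bar> \<le> V"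
  shows "\<bar>dx t\<bar> \<le> \<beta> t * (Lip * V)"
proof -
  let ?p = "x (t - \<tau> t) - K" and ?q = "x (t - \<sigma> t) - K"
  have pq: "\<bar>?p\<bar> \<le> V" "\<bar>?q\<bar> \<le> V" "\<bar>x t - K\<bar> \<le> V" "0 \<le> x (t - \<sigma> t)"
    using \<sigma>[OF assms(1)] \<tau>[OF assms(1)] assms(1) r_nonneg by (auto intro!: V x_nonneg)
  have e: "exp (- ?q) \<le> exp K" using pq(4) by simp
  have "\<bar>exp (- ?q) - 1\<bar> \<le> exp K * \<bar>?q\<bar>"
  proof (cases "0 \<le> ?q")
    case True
    have "1 - exp (- ?q) \<le> ?q" using exp_ge_add_one_self[of "- ?q"] by linarith
    also have "?q = 1 * ?q" by simp
    also have "\<dots> \<le> exp K * ?q" using True K_pos by (intro mult_right_mono) auto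
    finally show ?thesis using True by simp
  next
    case False
    have q: "1 - exp ?q \<le> - ?q" using exp_ge_add_one_self[of ?q] by linarith
    have "exp (- ?q) - 1 = exp (- ?q) * (1 - exp ?q)" by (simp add: right_diff_distrib mult_exp_exp)
    also have "\<dots> \<le> exp K * (- ?q)"
      using e False q by (intro mult_mono) auto
    finally show ?thesis using False by simp
  qed
  also have "\<dots> \<le> exp K * V" using pq by (intro mult_left_mono) auto
  finally have e1: "\<bar>exp (- ?q) - 1\<bar> \<le> exp K * V" .
  have "dx t = \<beta> t * (?p * exp (- ?q) + K * (exp (- ?q) - 1) - (x t - K))"
    by (simp add: dx_def algebra_simps)
  then have "\<bar>dx t\<bar> = \<beta> t * \<bar>?p * exp (- ?q) + K * (exp (- ?q) - 1) - (x t - K)\<bar>"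
    using \<beta>[OF assms(1)] b0_pos by (simp add: abs_mult)
  also have "\<dots> \<le> \<beta> t * (Lip * V)"
  proof (intro mult_left_mono)
    have "\<bar>?p * exp (- ?q) + K * (exp (- ?q) - 1) - (x t - K)\<bar>
        \<le> \<bar>?p * exp (- ?q)\<bar> + \<bar>K * (exp (- ?q) - 1)\<bar> + \<bar>x t - K\<bar>" by linarith
    also have "\<dots> \<le> V * exp K + K * (exp K * V) + V"
      unfolding abs_mult using pq e e1 K_pos by (intro add_mono mult_mono) auto
    also have "\<dots> = Lip * V" by (simp add: Lip_def algebra_simps)
    finally show "\<bar>?p * exp (- ?q) + K * (exp (- ?q) - 1) - (x t - K)\<bar> \<le> Lip * V" .
  qed (use \<beta>[OF assms(1)] b0_pos in auto)
  finally show ?thesis .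
qed

text \<open>Within time \<open>1 / (2 * b1 * Lip)\<close> the mean value theorem lets
  \<open>x\<close> move by at most half of the maximal deviation \<open>D\<close>, so
  \<open>D \<le> D / 2 + A\<close>.\<close>

lemma deviation_doubles:
  assumes "t0 \<le> s" and A: "\<And>u. t0 - r \<le> u \<Longrightarrow> u \<le> s \<Longrightarrow> \<bar>x u - K\<bar> \<le> A"
    and u: "t0 - r \<le> u" "u \<le> s + 1 / (2 * b1 * Lip)"
  shows "\<bar>x u - K\<bar> \<le> 2 * A"
proof -
  define h where "h = 1 / (2 * b1 * Lip)"
  have h: "0 < h" "b1 * Lip * h = 1 / 2" using b1_pos Lip_ge by (auto simp: h_def)
  have "0 \<le> A" using A[of s] assms(1) r_nonneg by fastforce
  have "continuous_on {s..s + h} (\<lambda>u. \<bar>x u - K\<bar>)" by (intro continuous_intros x_continuous assms)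
  then obtain m where m: "s \<le> m" "m \<le> s + h" "\<And>u. s \<le> u \<Longrightarrow> u \<le> s + h \<Longrightarrow> \<bar>x u - K\<bar> \<le> \<bar>x m - K\<bar>"
    using continuous_attains_sup[of "{s..s + h}" "\<lambda>u. \<bar>x u - K\<bar>"] h by auto
  have "\<bar>x m - K\<bar> \<le> 2 * A"
  proof (rule ccontr)
    assume "\<not> ?thesis"
    then have mA: "2 * A < \<bar>x m - K\<bar>" by simp
    have "s < m" using A[of s] m mA assms(1) r_nonneg \<open>0 \<le> A\<close> by (cases "s = m") auto
    obtain v where v: "s < v" "v < m" "x m - x s = (m - s) * dx v"
    proof -
      have d: "DERIV x u :> dx u" if "s < u" for u using that assms(1) by (intro x_DERIV) auto
      then obtain l v where "s < v" "v < m" "DERIV x v :> l" "x m - x s = (m - s) * l"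
        using MVT[OF \<open>s < m\<close> x_continuous[OF assms(1)]] real_differentiable_def by metis
      then show ?thesis using DERIV_unique d that by metis
    qed
    have "t0 \<le> v" using v assms by simp
    have "\<bar>x w - K\<bar> \<le> \<bar>x m - K\<bar>" if "v - r \<le> w" "w \<le> v" for w
    proof (cases "w \<le> s")
      case True
      then show ?thesis using A[of w] that v assms(1) mA \<open>0 \<le> A\<close> by simp
    qed (use m that v in auto)
    then have "\<bar>dx v\<bar> \<le> \<beta> v * (Lip * \<bar>x m - K\<bar>)" using dx_lipschitz[OF \<open>t0 \<le> v\<close>] by blast
    also have "\<dots> \<le> b1 * (Lip * \<bar>x m - K\<bar>)"
      using \<beta>[OF \<open>t0 \<le> v\<close>] Lip_ge by (intro mult_right_mono) auto
    finally have "\<bar>x m - x s\<bar> \<le> h * (b1 * (Lip * \<bar>x m - K\<bar>))"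
      unfolding v(3) abs_mult using m h v by (intro mult_mono) auto
    also have "\<dots> = b1 * Lip * h * \<bar>x m - K\<bar>" by simp
    also have "\<dots> = \<bar>x m - K\<bar> / 2" unfolding h by simp
    finally have "\<bar>x m - x s\<bar> \<le> \<bar>x m - K\<bar> / 2" .
    moreover have "\<bar>x s - K\<bar> \<le> A" using A[of s] assms(1) r_nonneg by simp
    moreover have "\<bar>x m - K\<bar> \<le> \<bar>x m - x s\<bar> + \<bar>x s - K\<bar>" by simp
    ultimately have "\<bar>x m - K\<bar> \<le> \<bar>x m - K\<bar> / 2 + A" by (meson add_mono order_trans)
    then show False using mA by (simp add: field_simps)
  qed
  then show ?thesis using m(3)[of u] A[of u] u \<open>0 \<le> A\<close> by (cases "u \<le> s") (auto simp: h_def)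
qed

lemma deviation_growth:
  assumes A: "\<And>u. t0 - r \<le> u \<Longrightarrow> u \<le> t0 \<Longrightarrow> \<bar>x u - K\<bar> \<le> A"
    and "t0 - r \<le> u" "u \<le> t0 + real n / (2 * b1 * Lip)"
  shows "\<bar>x u - K\<bar> \<le> 2 ^ n * A"
  using assms(2,3)
proof (induction n arbitrary: u)
  case 0
  then show ?case using A by simp
next
  case (Suc n)
  have "0 \<le> real n / (2 * b1 * Lip)" using b1_pos Lip_ge by simp
  then have "\<bar>x u - K\<bar> \<le> 2 * (2 ^ n * A)"
    using Suc by (intro deviation_doubles[of "t0 + real n / (2 * b1 * Lip)"]) (auto simp: add_divide_distrib)
  then show ?case by simp
qed

section \<open>Small deviations do not increase at large times\<close>

text \<open>At a first time \<open>h\<close> with deviation \<open>V\<close>, the sign of the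
  derivative and the bound \<open>V\<close> at \<open>h - \<tau> h\<close> place
  \<open>x (h - \<sigma> h)\<close> weakly on the other side of \<open>K\<close>. Then
  \<open>first_hit_impossible\<close> for \<open>x - K\<close> or \<open>K - x\<close> rules the hit
  out; the conditions on \<open>c\<close> and \<open>\<epsilon>\<close> are its smallness conditions
  divided by \<open>V\<close>.\<close>

lemma small_deviation_persists:
  assumes c: "0 \<le> c" "c \<le> \<zeta>" "c * Lip \<le> 1 / 2"
    and \<epsilon>: "0 < \<epsilon>" "(1 - exp (- (\<zeta> + \<epsilon> - c))) * ((1 + K) * exp \<epsilon>) < 1"
      "exp (- c) * ((1 - exp (- (\<zeta> + \<epsilon> - c))) * ((1 + K) * exp \<epsilon>))
        + (1 - exp (- c)) * ((1 + K / 2) * exp \<epsilon>) < 1"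
    and V: "0 < V" "V < K" "V \<le> \<epsilon>"
    and T: "t0 + 2 * r \<le> T" "\<And>t. T \<le> t \<Longrightarrow> B t - B (t - \<sigma> t) \<le> \<zeta> + \<epsilon>"
    and init: "\<And>t. t0 \<le> t \<Longrightarrow> t \<le> T + r \<Longrightarrow> \<bar>x t - K\<bar> < V"
    and "t0 \<le> t"
  shows "\<bar>x t - K\<bar> < V"
proof (rule ccontr)
  assume nlt: "\<not> \<bar>x t - K\<bar> < V"
  \<comment> \<open>\<open>1 + K\<close> is the linearised gain: \<open>1\<close> from
    \<open>x (u - \<tau> u)\<close>, \<open>K\<close> from the exponential. As
    \<open>V \<le> \<epsilon>\<close>, the factor \<open>exp \<epsilon>\<close> absorbs the
    nonlinear error. In \<open>G2\<close> the adverse deviation at \<open>u - \<sigma> u\<close> is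
    at most \<open>V / 2\<close>, which halves \<open>K\<close>.\<close>
  define G1 G2 where "G1 = (1 + K) * exp \<epsilon> * V" and "G2 = (1 + K / 2) * exp \<epsilon> * V"
  have "continuous_on {t0..t} (\<lambda>u. \<bar>x u - K\<bar>)" by (intro continuous_intros x_continuous order_refl)
  then obtain h where h: "t0 < h" "h \<le> t" "\<bar>x h - K\<bar> = V"
      "\<And>u. t0 \<le> u \<Longrightarrow> u < h \<Longrightarrow> \<bar>x u - K\<bar> < V"
    using nlt init[of t0] \<open>t0 \<le> t\<close> T(1) r_nonneg
    by - (rule first_hitting_time[of t0 t "\<lambda>u. \<bar>x u - K\<bar>" V], auto)
  have hT: "T + r < h" using init[of h] h by force
  have le: "\<bar>x u - K\<bar> \<le> V" if "t0 \<le> u" "u \<le> h" for u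
    using h(3) h(4)[of u] that by (cases "u = h") auto
  have h0: "t0 \<le> h" using h by simp
  note \<sigma>h = \<sigma>[OF h0]
  have half: "exp b - 1 \<le> b * exp \<epsilon>" if "0 \<le> b" "b \<le> V" for b
  proof -
    have "exp b - 1 = exp b * (1 - exp (- b))" by (simp add: right_diff_distrib mult_exp_exp)
    also have "\<dots> \<le> exp \<epsilon> * b" using that V exp_ge_add_one_self[of "- b"] by (intro mult_mono) auto
    finally show ?thesis by (simp add: mult.commute)
  qed
  have past: "\<bar>x (u - \<tau> u) - K\<bar> \<le> V" "\<bar>x (u - \<sigma> u) - K\<bar> \<le> V"
    if "t0 + r \<le> u" "u \<le> h" for u
  proof -
    have "t0 \<le> u" using that r_nonneg by simp
    then show "\<bar>x (u - \<tau> u) - K\<bar> \<le> V" "\<bar>x (u - \<sigma> u) - K\<bar> \<le> V"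
      using \<sigma>[of u] \<tau>[of u] that by (auto intro!: le)
  qed
  \<comment> \<open>\<open>b\<close> bounds the adverse deviation at \<open>u - \<sigma> u\<close>:
    \<open>b = V\<close> yields \<open>G1\<close> and \<open>b = V / 2\<close> yields
    \<open>G2\<close>.\<close>
  have up: "dx u \<le> \<beta> u * (V * exp \<epsilon> + K * (b * exp \<epsilon>) - (x u - K))"
    if "t0 + r \<le> u" "u \<le> h" "0 \<le> b" "b \<le> V" "K - x (u - \<sigma> u) \<le> b" for u b
  proof -
    have "x (u - \<tau> u) * exp (K - x (u - \<sigma> u)) \<le> (K + V) * exp b"
      using past[OF that(1,2)] that V by (intro mult_mono) auto
    also have "\<dots> = V * exp b + K * (exp b - 1) + K" by (simp add: algebra_simps)
    also have "\<dots> \<le> V * exp \<epsilon> + K * (b * exp \<epsilon>) + K"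
      using half[OF that(3,4)] V that K_pos by (intro add_mono mult_left_mono) auto
    finally show ?thesis
      unfolding dx_def using \<beta>[of u] b0_pos that r_nonneg by (intro mult_left_mono) auto
  qed
  \<comment> \<open>Downwards, \<open>1 - exp (- b) \<le> b\<close> holds without correction; the
    factors \<open>exp \<epsilon>\<close> are slack that lets both signs share \<open>G1\<close> and
    \<open>G2\<close>.\<close>
  have low: "- dx u \<le> \<beta> u * (V * exp \<epsilon> + K * (b * exp \<epsilon>) - (K - x u))"
    if "t0 + r \<le> u" "u \<le> h" "0 \<le> b" "b \<le> V" "x (u - \<sigma> u) - K \<le> b" for u b
  proof -
    have e1: "exp \<epsilon> \<ge> 1" using \<epsilon> by simp
    have "1 - exp (- b) \<le> b" using exp_ge_add_one_self[of "- b"] by simp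
    also have "\<dots> \<le> b * exp \<epsilon>" using mult_left_mono[OF e1 that(3)] by simp
    finally have "K * (1 - exp (- b)) \<le> K * (b * exp \<epsilon>)" using K_pos by (intro mult_left_mono) auto
    moreover have "V * exp (- b) \<le> V * exp \<epsilon>" using V \<epsilon> that by (intro mult_left_mono) auto
    moreover have "(K - V) * exp (- b) \<le> x (u - \<tau> u) * exp (K - x (u - \<sigma> u))"
      using past[OF that(1,2)] that V by (intro mult_mono) auto
    ultimately have "x u - x (u - \<tau> u) * exp (K - x (u - \<sigma> u))
        \<le> V * exp \<epsilon> + K * (b * exp \<epsilon>) - (K - x u)" by (simp add: algebra_simps)
    then have "\<beta> u * (x u - x (u - \<tau> u) * exp (K - x (u - \<sigma> u)))
        \<le> \<beta> u * (V * exp \<epsilon> + K * (b * exp \<epsilon>) - (K - x u))"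
      using \<beta>[of u] b0_pos that r_nonneg by (intro mult_left_mono) auto
    then show ?thesis by (simp add: dx_def algebra_simps)
  qed
  have G: "G1 = V * exp \<epsilon> + K * (V * exp \<epsilon>)" "G2 = V * exp \<epsilon> + K * (V / 2 * exp \<epsilon>)"
    by (simp_all add: G1_def G2_def algebra_simps)
  \<comment> \<open>As \<open>init\<close> reaches to \<open>T + r\<close>, all times back to
    \<open>h - \<sigma> h\<close> are past \<open>T\<close>, where the delay bound holds; one
    further delay stays past \<open>t0 + r\<close>.\<close>
  have \<sigma>': "t0 + r \<le> u - \<sigma> u \<and> 0 \<le> \<sigma> u \<and> B u - B (u - \<sigma> u) \<le> \<zeta> + \<epsilon>"
    if "h - \<sigma> h \<le> u" "u \<le> h" for u
  proof -
    have "T \<le> u" using that \<sigma>h hT by simp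
    then show ?thesis using T \<sigma>[of u] r_nonneg by force
  qed
  have G0: "0 \<le> G1" using V K_pos by (simp add: G1_def)
  have small: "(1 - exp (- (\<zeta> + \<epsilon> - c))) * G1 < V"
      "exp (- c) * ((1 - exp (- (\<zeta> + \<epsilon> - c))) * G1) + (1 - exp (- c)) * G2 < V"
    using mult_strict_right_mono[OF \<epsilon>(2) V(1)] mult_strict_right_mono[OF \<epsilon>(3) V(1)]
    by (simp_all add: G1_def G2_def algebra_simps)
  have c': "c \<le> \<zeta> + \<epsilon>" using c \<epsilon> by simp
  have lip: "\<bar>dx u\<bar> \<le> \<beta> u * (Lip * V)" if "t0 + r < u" "u < h" for u
    using that r_nonneg by (intro dx_lipschitz le) auto
  have h2: "t0 + 2 * r < h - r" using hT T by simp
  have past_h: "\<bar>x (h - \<tau> h) - K\<bar> \<le> V" using h2 r_nonneg by (intro past) auto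
  consider "x h = K + V" | "x h = K - V" using h(3) by linarith
  then show False
  proof cases
    case 1
    have "0 \<le> dx h"
      using h(4) 1 by (intro DERIV_nonneg_at_left_max[OF x_DERIV[OF h(1)] h(1)]) force
    then have "(K + V) * 1 \<le> x (h - \<tau> h) * exp (K - x (h - \<sigma> h))"
      using dx_ge_imp[OF h0, of 0] 1 by simp
    also have "\<dots> \<le> (K + V) * exp (K - x (h - \<sigma> h))"
      using past_h by (intro mult_right_mono) auto
    finally have neg: "x (h - \<sigma> h) - K \<le> 0" using V K_pos by simp
    show False
    proof (rule first_hit_impossible[where a = "t0 + r" and t = h and z = "\<lambda>u. x u - K" and z' = dx
          and B = B and \<beta> = \<beta> and \<sigma> = \<sigma> and \<xi> = "\<zeta> + \<epsilon>" and C = Lip and V = V and c = c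
          and ?G1.0 = G1 and ?G2.0 = G2])
      fix u assume u: "t0 + r < u" "u < h"
      then have "t0 < u" using r_nonneg by simp
      then show "DERIV (\<lambda>u. x u - K) u :> dx u" "DERIV B u :> \<beta> u" "0 \<le> \<beta> u"
        using x_DERIV B_DERIV \<beta>[of u] b0_pos by (auto intro!: derivative_eq_intros)
      show "dx u \<le> \<beta> u * (Lip * V)" using lip[OF u] by simp
    next
      fix u assume u: "h - \<sigma> h < u" "u < h"
      then have "t0 + r \<le> u" "t0 \<le> u" using \<sigma>h h2 r_nonneg by auto
      show "dx u \<le> \<beta> u * (G1 - (x u - K))"
        unfolding G using past(2)[of u] u V \<open>t0 + r \<le> u\<close> by (intro up) auto
      show "dx u \<le> \<beta> u * (G2 - (x u - K))" if "- V / 2 \<le> x (u - \<sigma> u) - K"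
        unfolding G using that u V \<open>t0 + r \<le> u\<close> by (intro up) auto
    qed (use 1 neg \<sigma>' \<sigma>h small c' c G0 V Lip_ge r_nonneg
        in \<open>auto intro!: continuous_intros x_continuous B_continuous\<close>)
  next
    case 2
    have "0 \<le> - dx h"
      using h(4) 2 by (intro DERIV_nonneg_at_left_max[OF DERIV_minus[OF x_DERIV[OF h(1)]] h(1)]) force
    then have le2: "x (h - \<tau> h) * exp (K - x (h - \<sigma> h)) \<le> (K - V) * 1"
      using dx_le_imp[OF h0, of 0] 2 by simp
    have "(K - V) * exp (K - x (h - \<sigma> h)) \<le> x (h - \<tau> h) * exp (K - x (h - \<sigma> h))"
      using past_h by (intro mult_right_mono) auto
    from order_trans[OF this le2] have neg: "K - x (h - \<sigma> h) \<le> 0" using V by simp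
    show False
    proof (rule first_hit_impossible[where a = "t0 + r" and t = h and z = "\<lambda>u. K - x u"
          and z' = "\<lambda>u. - dx u"
          and B = B and \<beta> = \<beta> and \<sigma> = \<sigma> and \<xi> = "\<zeta> + \<epsilon>" and C = Lip and V = V and c = c
          and ?G1.0 = G1 and ?G2.0 = G2])
      fix u assume u: "t0 + r < u" "u < h"
      then have "t0 < u" using r_nonneg by simp
      then show "DERIV (\<lambda>u. K - x u) u :> - dx u" "DERIV B u :> \<beta> u" "0 \<le> \<beta> u"
        using x_DERIV B_DERIV \<beta>[of u] b0_pos by (auto intro!: derivative_eq_intros)
      show "- dx u \<le> \<beta> u * (Lip * V)" using lip[OF u] by simp
    next
      fix u assume u: "h - \<sigma> h < u" "u < h"
      then have "t0 + r \<le> u" "t0 \<le> u" using \<sigma>h h2 r_nonneg by auto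
      show "- dx u \<le> \<beta> u * (G1 - (K - x u))"
        unfolding G using past(2)[of u] u V \<open>t0 + r \<le> u\<close> by (intro low) auto
      show "- dx u \<le> \<beta> u * (G2 - (K - x u))" if "- V / 2 \<le> K - x (u - \<sigma> u)"
        unfolding G using that u V \<open>t0 + r \<le> u\<close> by (intro low) auto
    qed (use 2 neg \<sigma>' \<sigma>h small c' c G0 V Lip_ge r_nonneg
        in \<open>auto intro!: continuous_intros x_continuous B_continuous\<close>)
  qed
qed

end

section \<open>Constants for stability, uniform over solutions\<close>

context normalized_nicholson
begin

text \<open>No solution is fixed here: \<open>c\<close>, \<open>\<epsilon>\<close>,
  \<open>V\<close>, \<open>T\<close> and \<open>n\<close> depend only on the equation and on
  \<open>e\<close>, so \<open>\<eta>\<close> serves all initial functions.\<close>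

lemma uniformly_stable:
  assumes "0 < e"
  obtains \<eta> where "0 < \<eta>"
    "\<And>x t. normalized_solution t0 r K \<zeta> b0 b1 \<beta> \<sigma> \<tau> B x \<Longrightarrow>
      (\<And>u. t0 - r \<le> u \<Longrightarrow> u \<le> t0 \<Longrightarrow> \<bar>x u - K\<bar> \<le> \<eta>) \<Longrightarrow> t0 \<le> t \<Longrightarrow> \<bar>x t - K\<bar> < e"
proof -
  \<comment> \<open>With \<open>c * Lip \<le> 1 / 2\<close>, a deviation can rise by at most
    \<open>V / 2\<close> within \<open>B\<close>-time \<open>c\<close>.\<close>
  define c where "c = min \<zeta> (1 / (2 * Lip))"
  have c: "0 \<le> c" "c \<le> \<zeta>" "c * Lip \<le> 1 / 2"
    using \<zeta>_nonneg Lip_ge by (auto simp: c_def min_def field_simps)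
  have K1: "(1 - exp (- \<zeta>)) * (1 + K) \<le> 1" using K_weight by (simp add: algebra_simps)
  have lim1: "(1 - exp (- (\<zeta> - c))) * (1 + K) < 1"
    and lim2: "exp (- c) * ((1 - exp (- (\<zeta> - c))) * (1 + K)) + (1 - exp (- c)) * (1 + K / 2) < 1"
  proof -
    \<comment> \<open>At \<open>\<epsilon> = 0\<close> the second quantity is
      \<open>(1 - exp (- \<zeta>)) * (1 + K)\<close>, at most \<open>1\<close>, minus the gain
      \<open>(1 - exp (- c)) * (K / 2)\<close>. For \<open>\<zeta> > 0\<close> the gain is positive;
      for \<open>\<zeta> = 0\<close> everything vanishes. Either way there is room for a small
      \<open>\<epsilon>\<close>.\<close>
    have eq: "exp (- c) * ((1 - exp (- (\<zeta> - c))) * (1 + K)) + (1 - exp (- c)) * (1 + K / 2)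
        = (1 - exp (- \<zeta>)) * (1 + K) - (1 - exp (- c)) * (K / 2)"
    proof -
      have w: "exp (- c) * exp (- (\<zeta> - c)) = exp (- \<zeta>)" by (simp add: mult_exp_exp)
      have "exp (- c) * ((1 - exp (- (\<zeta> - c))) * (1 + K))
          = (exp (- c) - exp (- c) * exp (- (\<zeta> - c))) * (1 + K)"
        by (simp only: left_diff_distrib right_diff_distrib mult.assoc mult_1_left mult_1_right)
      then show ?thesis unfolding w by (simp add: algebra_simps)
    qed
    have "(1 - exp (- (\<zeta> - c))) * (1 + K) < 1 \<and>
        (1 - exp (- \<zeta>)) * (1 + K) - (1 - exp (- c)) * (K / 2) < 1"
    proof (cases "\<zeta> = 0")
      case True
      then show ?thesis using c by simp
    next
      case False
      then have "0 < c" using \<zeta>_nonneg Lip_ge by (simp add: c_def)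
      then have "(1 - exp (- (\<zeta> - c))) * (1 + K) < (1 - exp (- \<zeta>)) * (1 + K)"
        using K_pos by (intro mult_strict_right_mono) auto
      moreover have "0 < (1 - exp (- c)) * (K / 2)" using \<open>0 < c\<close> K_pos by simp
      ultimately show ?thesis using K1 by simp
    qed
    then show "(1 - exp (- (\<zeta> - c))) * (1 + K) < 1"
      "exp (- c) * ((1 - exp (- (\<zeta> - c))) * (1 + K)) + (1 - exp (- c)) * (1 + K / 2) < 1"
      unfolding eq by auto
  qed
  have "((\<lambda>\<epsilon>. (1 - exp (- (\<zeta> + \<epsilon> - c))) * ((1 + K) * exp \<epsilon>))
      \<longlongrightarrow> (1 - exp (- (\<zeta> - c))) * (1 + K)) (at_right 0)"
    by (auto intro!: tendsto_eq_intros)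
  then have ev1: "\<forall>\<^sub>F \<epsilon> in at_right 0. (1 - exp (- (\<zeta> + \<epsilon> - c))) * ((1 + K) * exp \<epsilon>) < 1"
    using lim1 by (rule order_tendstoD)
  have "((\<lambda>\<epsilon>. exp (- c) * ((1 - exp (- (\<zeta> + \<epsilon> - c))) * ((1 + K) * exp \<epsilon>))
        + (1 - exp (- c)) * ((1 + K / 2) * exp \<epsilon>))
      \<longlongrightarrow> exp (- c) * ((1 - exp (- (\<zeta> - c))) * (1 + K)) + (1 - exp (- c)) * (1 + K / 2)) (at_right 0)"
    by (auto intro!: tendsto_eq_intros)
  then have ev2: "\<forall>\<^sub>F \<epsilon> in at_right 0. exp (- c) * ((1 - exp (- (\<zeta> + \<epsilon> - c))) * ((1 + K) * exp \<epsilon>))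
        + (1 - exp (- c)) * ((1 + K / 2) * exp \<epsilon>) < 1"
    using lim2 by (rule order_tendstoD)
  obtain \<epsilon> where \<epsilon>: "0 < \<epsilon>" "(1 - exp (- (\<zeta> + \<epsilon> - c))) * ((1 + K) * exp \<epsilon>) < 1"
      "exp (- c) * ((1 - exp (- (\<zeta> + \<epsilon> - c))) * ((1 + K) * exp \<epsilon>))
        + (1 - exp (- c)) * ((1 + K / 2) * exp \<epsilon>) < 1"
    using eventually_at_right_0_witness[OF eventually_conj[OF ev1 ev2]] by blast
  define V where "V = min e (min (K / 2) \<epsilon>)"
  have V: "0 < V" "V < K" "V \<le> \<epsilon>" "V \<le> e" using assms K_pos \<epsilon> by (auto simp: V_def)
  obtain T0 where T0: "\<And>t. T0 \<le> t \<Longrightarrow> B t - B (t - \<sigma> t) \<le> \<zeta> + \<epsilon>"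
    using B_delay[OF \<epsilon>(1)] by (auto simp: eventually_at_top_linorder)
  define T where "T = max T0 (t0 + 2 * r)"
  have T: "t0 + 2 * r \<le> T" "\<And>t. T \<le> t \<Longrightarrow> B t - B (t - \<sigma> t) \<le> \<zeta> + \<epsilon>"
    using T0 by (auto simp: T_def)
  \<comment> \<open>\<open>n\<close> doubling steps lead from \<open>t0\<close> past
    \<open>T + r\<close>; the extra factor \<open>2\<close> in \<open>V / 2 ^ Suc n\<close> below
    makes the resulting bound strict.\<close>
  obtain n where n: "(T + r - t0) * (2 * b1 * Lip) \<le> real n" using real_arch_simple by blast
  have pos: "0 < 2 * b1 * Lip" using b1_pos Lip_ge by simp
  have n': "T + r \<le> t0 + real n / (2 * b1 * Lip)"
    using pos_le_divide_eq[OF pos, of "T + r - t0" "real n"] n by simp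
  show ?thesis
  proof (rule that[of "V / 2 ^ Suc n"])
    show "0 < V / 2 ^ Suc n" using V by simp
    fix x t assume x: "normalized_solution t0 r K \<zeta> b0 b1 \<beta> \<sigma> \<tau> B x" and "t0 \<le> t"
      and init: "\<And>u. t0 - r \<le> u \<Longrightarrow> u \<le> t0 \<Longrightarrow> \<bar>x u - K\<bar> \<le> V / 2 ^ Suc n"
    interpret normalized_solution t0 r K \<zeta> b0 b1 \<beta> \<sigma> \<tau> B x by (rule x)
    have early: "\<bar>x u - K\<bar> < V" if "t0 \<le> u" "u \<le> T + r" for u
    proof -
      have "\<bar>x u - K\<bar> \<le> 2 ^ n * (V / 2 ^ Suc n)"
        by (rule deviation_growth[OF init]) (use that n' r_nonneg in auto)
      also have "\<dots> < V" using V by simp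
      finally show ?thesis .
    qed
    have "\<bar>x t - K\<bar> < V"
      by (rule small_deviation_persists[OF c \<epsilon> V(1-3) T early \<open>t0 \<le> t\<close>])
    then show "\<bar>x t - K\<bar> < e" using V by simp
  qed
qed

end

section \<open>Reduction of the original equation to the rescaled one\<close>

text \<open>The first alternative gives \<open>z * k < 1 - 2 * z\<close>, hence
  \<open>z < 1\<close>; with \<open>exp z - 1 \<le> z / (1 - z)\<close> this yields
  \<open>k * (exp z - 1) \<le> z * k / (1 - z) \<le> 1\<close>. The second alternative contains the
  claim.\<close>

lemma delay_condition:
  fixes z k :: real
  assumes "0 \<le> z" "0 < k"
    and "(k \<le> A \<and> z * (2 + k) < 1) \<or> (k > A \<and> (exp z - 1) * k \<le> 1)"
  shows "k * (exp z - 1) \<le> 1"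
  using assms(3)
proof
  assume "k \<le> A \<and> z * (2 + k) < 1"
  then have zk: "z * k < 1 - 2 * z" by (simp add: algebra_simps)
  then have z: "z < 1" using assms mult_nonneg_nonneg[of z k] by linarith
  have "1 - z \<le> exp (- z)" using exp_ge_add_one_self[of "- z"] by linarith
  then have "(1 - z) * exp z \<le> exp (- z) * exp z" by (rule mult_right_mono) simp
  then have "(1 - z) * (exp z - 1) \<le> z" by (simp add: mult_exp_exp algebra_simps)
  then have "(1 - z) * (k * (exp z - 1)) \<le> z * k"
    using assms(2) mult_right_mono[of "(1 - z) * (exp z - 1)" z k] by (simp add: mult_ac)
  also have "\<dots> \<le> (1 - z) * 1" using zk assms by simp
  finally show ?thesis using z by simp
qed (simp add: mult.commute)

lemma le_max_delay:
  assumes "bounded (\<sigma> ` {t0..})" "bounded (\<tau> ` {t0..})" "t0 \<le> t"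
  shows "\<sigma> t \<le> max_delay t0 \<sigma> \<tau>" "\<tau> t \<le> max_delay t0 \<sigma> \<tau>"
proof -
  have "\<sigma> t \<le> (SUP t\<in>{t0..}. \<sigma> t)" "\<tau> t \<le> (SUP t\<in>{t0..}. \<tau> t)"
    using assms by (auto intro!: cSUP_upper bounded_imp_bdd_above)
  then show "\<sigma> t \<le> max_delay t0 \<sigma> \<tau>" "\<tau> t \<le> max_delay t0 \<sigma> \<tau>"
    unfolding max_delay_def by linarith+
qed

lemma abs_le_sup_norm:
  assumes "continuous_on {-r..0} \<phi>" "\<theta> \<in> {-r..0}"
  shows "\<bar>\<phi> \<theta>\<bar> \<le> sup_norm r \<phi>"
  unfolding sup_norm_def
proof (rule cSUP_upper[OF assms(2)])
  have "compact ((\<lambda>\<theta>. \<bar>\<phi> \<theta>\<bar>) ` {-r..0})"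
    by (intro compact_continuous_image continuous_intros assms) simp
  then show "bdd_above ((\<lambda>\<theta>. \<bar>\<phi> \<theta>\<bar>) ` {-r..0})"
    by (intro bounded_imp_bdd_above compact_imp_bounded)
qed

theorem theorem3p2:
  fixes t0 p a \<delta> K \<zeta> :: real and \<beta> \<sigma> \<tau> :: "real \<Rightarrow> real"
  assumes "0 < p" and "0 < a" and "0 < \<delta>"
    and "continuous_on {t0..} \<beta>" and "continuous_on {t0..} \<sigma>" and "continuous_on {t0..} \<tau>"
    and "\<forall>t\<ge>t0. 0 \<le> \<beta> t" and "\<forall>t\<ge>t0. 0 \<le> \<sigma> t" and "\<forall>t\<ge>t0. 0 \<le> \<tau> t"
    and "bounded (\<beta> ` {t0..})" and "bounded (\<sigma> ` {t0..})" and "bounded (\<tau> ` {t0..})"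
    and "0 < (INF t\<in>{t0..}. \<beta> t)"
    and "ereal \<zeta> = zeta_M \<beta> \<sigma>"
    and "\<delta> < p"
    and "K = 1 / a * ln (p / \<delta>)"
    and "(ln (p / \<delta>) \<le> 2 * \<delta> * \<zeta> / (exp (\<delta> * \<zeta>) - \<delta> * \<zeta> - 1) \<and>
          \<delta> * \<zeta> * (2 + ln (p / \<delta>)) < 1) \<or>
         (ln (p / \<delta>) > 2 * \<delta> * \<zeta> / (exp (\<delta> * \<zeta>) - \<delta> * \<zeta> - 1) \<and>
          (exp (\<delta> * \<zeta>) - 1) * ln (p / \<delta>) \<le> 1)"
  shows "globally_asymptotically_stable_in_C0_plus
           (nicholson_rhs p a \<delta> \<beta> \<sigma> \<tau>) t0 (max_delay t0 \<sigma> \<tau>) K"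
proof -
  note p = assms(1) and a = assms(2) and \<delta> = assms(3)
  define r where "r = max_delay t0 \<sigma> \<tau>"
  define k where "k = ln (p / \<delta>)"
  define B where "B t = \<delta> * integral {t0..t} \<beta>" for t
  define b0 where "b0 = \<delta> * (INF t\<in>{t0..}. \<beta> t)"
  have k: "0 < k" "exp k = p / \<delta>" "K = k / a" using p \<delta> assms(15,16) by (auto simp: k_def)
  obtain M where M: "\<And>t. t0 \<le> t \<Longrightarrow> \<beta> t \<le> M"
    using bounded_imp_bdd_above[OF assms(10)] by (auto simp: bdd_above_def)
  have int: "\<beta> integrable_on {s..t}" if "t0 \<le> s" for s t
    using assms(4) that by (intro integrable_continuous_real) (auto elim: continuous_on_subset)
  have \<sigma>r: "0 \<le> \<sigma> t \<and> \<sigma> t \<le> r" "0 \<le> \<tau> t \<and> \<tau> t \<le> r" if "t0 \<le> t" for t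
    using le_max_delay[OF assms(11,12) that] assms(8,9) that by (auto simp: r_def)
  have \<zeta>0: "0 \<le> \<zeta>"
  proof -
    have "0 \<le> zeta_M \<beta> \<sigma>" unfolding zeta_M_def
    proof (rule le_Limsup)
      have "0 \<le> ereal (integral {t - \<sigma> t..t} \<beta>)" if "t0 + r \<le> t" for t
      proof -
        have "t0 \<le> t" "t0 \<le> t - \<sigma> t" using \<sigma>r[of t] \<sigma>r[of t0] that by auto
        then show ?thesis using assms(7) int by (auto intro!: integral_nonneg)
      qed
      then show "\<forall>\<^sub>F t in at_top. 0 \<le> ereal (integral {t - \<sigma> t..t} \<beta>)"
        unfolding eventually_at_top_linorder by blast
    qed simp
    then show ?thesis by (simp add: assms(14)[symmetric])
  qed
  interpret normalized_nicholson t0 r k "\<delta> * \<zeta>" b0 "\<delta> * M" "\<lambda>t. \<delta> * \<beta> t" \<sigma> \<tau> B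
  proof
    show "0 < k" by fact
    show "0 \<le> \<delta> * \<zeta>" using \<zeta>0 \<delta> by simp
    then show "k * (exp (\<delta> * \<zeta>) - 1) \<le> 1" using delay_condition k(1) assms(17) unfolding k_def by blast
    show "0 < b0" using assms(13) \<delta> by (simp add: b0_def)
    show "b0 \<le> \<delta> * \<beta> t \<and> \<delta> * \<beta> t \<le> \<delta> * M" if "t0 \<le> t" for t
    proof -
      have "bdd_below (\<beta> ` {t0..})" using assms(7) by (auto simp: bdd_below_def)
      then have "(INF t\<in>{t0..}. \<beta> t) \<le> \<beta> t" using that by (intro cINF_lower) auto
      then show ?thesis using M[OF that] \<delta> by (simp add: b0_def)
    qed
    show "0 \<le> \<sigma> t \<and> \<sigma> t \<le> r" "0 \<le> \<tau> t \<and> \<tau> t \<le> r" if "t0 \<le> t" for t using \<sigma>r[OF that] .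
    show "(B has_real_derivative \<delta> * \<beta> t) (at t within {t0..})" if "t0 \<le> t" for t
    proof -
      \<comment> \<open>The fundamental theorem is applied on the compact interval
        \<open>{t0..t + 1}\<close>, which agrees with \<open>{t0..}\<close> near \<open>t\<close>,
        also at \<open>t = t0\<close>.\<close>
      have "((\<lambda>s. integral {t0..s} \<beta>) has_real_derivative \<beta> t) (at t within {t0..t + 1})"
        using that assms(4) by (intro integral_has_real_derivative) (auto elim: continuous_on_subset)
      moreover have "at t within {t0..t + 1} = at t within {t0..}"
        by (rule at_within_nhd[of _ "{..<t + 1}"]) auto
      ultimately show ?thesis unfolding B_def by (intro DERIV_cmult) simp
    qed
    show "\<forall>\<^sub>F t in at_top. B t - B (t - \<sigma> t) \<le> \<delta> * \<zeta> + \<epsilon>" if "0 < \<epsilon>" for \<epsilon>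
    proof -
      \<comment> \<open>A number strictly above the upper limit is eventually a bound; the margin
        \<open>\<epsilon> / \<delta>\<close> becomes \<open>\<epsilon>\<close> after multiplication
        by \<open>\<delta>\<close>.\<close>
      have "zeta_M \<beta> \<sigma> < ereal (\<zeta> + \<epsilon> / \<delta>)" using that \<delta> by (simp add: assms(14)[symmetric])
      then have "\<forall>\<^sub>F t in at_top. ereal (integral {t - \<sigma> t..t} \<beta>) < ereal (\<zeta> + \<epsilon> / \<delta>)"
        unfolding zeta_M_def by (rule Limsup_lessD)
      with eventually_ge_at_top[of "t0 + r"] show ?thesis
      proof eventually_elim
        case (elim t)
        then have "t0 \<le> t" "t0 \<le> t - \<sigma> t" using \<sigma>r[of t] \<sigma>r[of t0] by auto
        then have comb: "integral {t0..t - \<sigma> t} \<beta> + integral {t - \<sigma> t..t} \<beta> = integral {t0..t} \<beta>"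
          using \<sigma>r[of t] by (intro Henstock_Kurzweil_Integration.integral_combine int) auto
        have "B t - B (t - \<sigma> t) = \<delta> * integral {t - \<sigma> t..t} \<beta>"
          by (simp add: B_def distrib_left flip: comb)
        also have "\<dots> \<le> \<delta> * (\<zeta> + \<epsilon> / \<delta>)" using elim \<delta> by (intro mult_left_mono) auto
        finally show ?case using \<delta> by (simp add: distrib_left)
      qed
    qed
  qed
  \<comment> \<open>Multiplying by \<open>a\<close> normalises the exponent; writing
    \<open>p = \<delta> * exp k\<close> moves the coefficient into the exponential and the factor
    \<open>\<delta>\<close> into the clock.\<close>
  have sol: "normalized_solution t0 r k (\<delta> * \<zeta>) b0 (\<delta> * M) (\<lambda>t. \<delta> * \<beta> t) \<sigma> \<tau> B (\<lambda>t. a * x t)"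
    if \<phi>: "\<phi> \<in> C0_plus r" and x: "dde_solution (nicholson_rhs p a \<delta> \<beta> \<sigma> \<tau>) t0 r \<phi> x" for \<phi> x
  proof unfold_locales
    have init: "x t = \<phi> (t - t0)" if "t0 - r \<le> t" "t \<le> t0" for t
    proof -
      have "\<forall>\<theta>\<in>{-r..0}. x (t0 + \<theta>) = \<phi> \<theta>" using x unfolding dde_solution_def by (rule conjunct1)
      then have "x (t0 + (t - t0)) = \<phi> (t - t0)" by (rule bspec) (use that in simp)
      then show ?thesis by simp
    qed
    show "0 \<le> a * x t" if "t0 - r \<le> t" "t \<le> t0" for t
      using init[OF that] \<phi> that a by (cases "t = t0") (auto simp: C0_plus_def)
    show "0 < a * x t0" using init[of t0] \<phi> a r_nonneg by (simp add: C0_plus_def)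
    fix t assume "t0 \<le> t"
    then have "(x has_real_derivative \<beta> t * (p * x (t - \<tau> t) * exp (- a * x (t - \<sigma> t)) - \<delta> * x t))
        (at t within {t0..})"
      using x by (simp add: dde_solution_def nicholson_rhs_def segment_def)
    then have "((\<lambda>t. a * x t) has_real_derivative
        a * (\<beta> t * (p * x (t - \<tau> t) * exp (- a * x (t - \<sigma> t)) - \<delta> * x t))) (at t within {t0..})"
      by (rule DERIV_cmult)
    moreover have "exp (k - a * x (t - \<sigma> t)) = p / \<delta> * exp (- a * x (t - \<sigma> t))"
      using k(2) by (simp add: exp_diff exp_minus field_simps)
    ultimately show "((\<lambda>t. a * x t) has_real_derivative
        \<delta> * \<beta> t * (a * x (t - \<tau> t) * exp (k - a * x (t - \<sigma> t)) - a * x t)) (at t within {t0..})"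
      using \<delta> by (simp add: algebra_simps)
  qed
  have "globally_attractive_in_C0_plus (nicholson_rhs p a \<delta> \<beta> \<sigma> \<tau>) t0 r K"
    unfolding globally_attractive_in_C0_plus_def
  proof (intro ballI allI impI)
    fix \<phi> x assume "\<phi> \<in> C0_plus r" "dde_solution (nicholson_rhs p a \<delta> \<beta> \<sigma> \<tau>) t0 r \<phi> x"
    then have "((\<lambda>t. a * x t) \<longlongrightarrow> k) at_top" by (rule normalized_solution.attractive[OF sol])
    then have "((\<lambda>t. a * x t / a) \<longlongrightarrow> k / a) at_top" by (intro tendsto_divide tendsto_const) (use a in auto)
    then show "(x \<longlongrightarrow> K) at_top" using a k(3) by simp
  qed
  moreover have "stable_in_C0_plus (nicholson_rhs p a \<delta> \<beta> \<sigma> \<tau>) t0 r K"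
    unfolding stable_in_C0_plus_def
  proof (intro allI impI)
    fix \<epsilon> :: real assume "0 < \<epsilon>"
    then have "0 < a * \<epsilon>" using a by simp
    then obtain \<eta> where \<eta>: "0 < \<eta>"
      "\<And>y t. normalized_solution t0 r k (\<delta> * \<zeta>) b0 (\<delta> * M) (\<lambda>t. \<delta> * \<beta> t) \<sigma> \<tau> B y \<Longrightarrow>
        (\<And>u. t0 - r \<le> u \<Longrightarrow> u \<le> t0 \<Longrightarrow> \<bar>y u - k\<bar> \<le> \<eta>) \<Longrightarrow> t0 \<le> t \<Longrightarrow> \<bar>y t - k\<bar> < a * \<epsilon>"
      using uniformly_stable by blast
    \<comment> \<open>Because \<open>a * K = k\<close>, deviations scale exactly by
      \<open>a\<close>; this explains \<open>a * \<epsilon>\<close> above and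
      \<open>\<eta> / a\<close> below.\<close>
    have scale: "\<bar>a * y - k\<bar> = a * \<bar>y - K\<bar>" for y
    proof -
      have "a * y - k = a * (y - K)" using a k(3) by (simp add: algebra_simps)
      then show ?thesis using a by (simp add: abs_mult)
    qed
    show "\<exists>\<eta>>0. \<forall>\<phi>\<in>C0_plus r. \<forall>x. dde_solution (nicholson_rhs p a \<delta> \<beta> \<sigma> \<tau>) t0 r \<phi> x \<longrightarrow>
        sup_norm r (\<lambda>\<theta>. \<phi> \<theta> - K) < \<eta> \<longrightarrow> (\<forall>t\<ge>t0. \<bar>x t - K\<bar> < \<epsilon>)"
    proof (intro exI[of _ "\<eta> / a"] conjI ballI allI impI)
      show "0 < \<eta> / a" using \<eta> a by simp
      fix \<phi> x t
      assume \<phi>: "\<phi> \<in> C0_plus r" and x: "dde_solution (nicholson_rhs p a \<delta> \<beta> \<sigma> \<tau>) t0 r \<phi> x"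
        and small: "sup_norm r (\<lambda>\<theta>. \<phi> \<theta> - K) < \<eta> / a" and "t0 \<le> t"
      have "\<bar>a * x u - k\<bar> \<le> \<eta>" if "t0 - r \<le> u" "u \<le> t0" for u
      proof -
        have mem: "u - t0 \<in> {-r..0}" using that by simp
        have "\<forall>\<theta>\<in>{-r..0}. x (t0 + \<theta>) = \<phi> \<theta>" using x unfolding dde_solution_def by (rule conjunct1)
        then have "x (t0 + (u - t0)) = \<phi> (u - t0)" using mem by (rule bspec)
        moreover have "\<bar>\<phi> (u - t0) - K\<bar> \<le> sup_norm r (\<lambda>\<theta>. \<phi> \<theta> - K)"
          using \<phi> mem by (intro abs_le_sup_norm[of r "\<lambda>\<theta>. \<phi> \<theta> - K"] continuous_intros)
            (auto simp: C0_plus_def)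
        ultimately have "\<bar>x u - K\<bar> \<le> \<eta> / a" using small by simp
        then show ?thesis unfolding scale using a by (simp add: field_simps)
      qed
      then have "\<bar>a * x t - k\<bar> < a * \<epsilon>" using \<eta>(2)[OF sol[OF \<phi> x]] \<open>t0 \<le> t\<close> by blast
      then show "\<bar>x t - K\<bar> < \<epsilon>" unfolding scale using a by simp
    qed
  qed
  ultimately show ?thesis
    by (simp add: globally_asymptotically_stable_in_C0_plus_def r_def)
qed

end
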